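(* Let $A,B\in\mathbb{R}$ and $\phi_{A,B}(y) = Ay$ for $y\ge 0$, $\phi_{A,B}(y)=-By$ for $y<0$. Let $v:\mathbb{R}\times(0,\infty)\to\mathbb{R}$ be smooth, satisfy $|\partial_x^\ell v(x,t)|\le C_\ell t^{-\ell/4}$ for $\ell=0,1,2$, solve $$v(t) = e^{-t\partial_x^4}v_0 + \int_0^t \partial_x^2 e^{-(t-s)\partial_x^4}\big(\alpha[v]v_{xx}+F[v]\big)(s)\,ds$$ with $v_0 = \phi_{A,B}'$ (i.e. $v_0=-B$ on $x<0$, $v_0=A$ on $x>0$), and be self-similar: $v(\sigma^{1/4}x,\sigma t) = v(x,t)$ for all $x\in\mathbb{R}$, $t>0$, $\sigma>0$. Let $$U(x,t) := \big(e^{-t\partial_x^4}\phi_{A,B}\big)(x) + \int_0^t \Big(\partial_x e^{-(t-s)\partial_x^4}\big(\alpha[v]v_{xx}+F[v]\big)(s)\Big)(x)\,ds.$$ Then $U$ is uniformly continuous up to $t=0$ with $U(\cdot,0)=\phi_{A,B}$, $U_x=v$, $U$ solves $U_t = -\big((1+U_x^2)^{-1/2}\big(U_{xx}(1+U_x^2)^{-3/2}\big)_x\big)_x$, and $U$ is forward self-similar: $\sigma^{-1/4}U(\sigma^{1/4}x,\sigma t) = U(x,t)$ for all $x\in\mathbb{R}$, $t>0$, $\sigma>0$.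
   Context: $e^{-t\partial_x^4}$ denotes the biharmonic heat semigroup on $\mathbb{R}$ (convolution with $G_t(x)=t^{-1/4}G(xt^{-1/4})$, $G$ the inverse Fourier transform of $e^{-\xi^4}$). $\alpha[v] = 1-(1+v^2)^{-2}$ and $F[v] = 3vv_x^2/(1+v^2)^3$. *)

theory Defs
  imports "HOL-Analysis.Analysis"
begin

fun Ck :: "nat \<Rightarrow> (real \<times> real) set \<Rightarrow> (real \<times> real \<Rightarrow> real) \<Rightarrow> bool" where
  "Ck 0 S f = continuous_on S f"
| "Ck (Suc k) S f = (continuous_on S f \<and>
     (\<exists>f1 f2. (\<forall>p\<in>S. (f has_derivative (\<lambda>h. fst h * f1 p + snd h * f2 p)) (at p))
              \<and> Ck k S f1 \<and> Ck k S f2))"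

definition smooth2_on :: "(real \<times> real) set \<Rightarrow> (real \<times> real \<Rightarrow> real) \<Rightarrow> bool" where
  "smooth2_on S f \<longleftrightarrow> (\<forall>k. Ck k S f)"

text \<open>Biharmonic heat kernel: G = inverse Fourier transform of exp(-xi^4),
  G(x) = (1/(2 pi)) \<integral> exp(i x xi) exp(-xi^4) d xi (real since the symbol is even).\<close>
definition Gbh :: "real \<Rightarrow> real" where
  "Gbh x = integral UNIV (\<lambda>\<xi>. exp (-(\<xi> ^ 4)) * cos (x * \<xi>)) / (2 * pi)"

definition Gbh_t :: "real \<Rightarrow> real \<Rightarrow> real" where
  "Gbh_t t x = t powr (-1/4) * Gbh (x * t powr (-1/4))"

definition biheat :: "real \<Rightarrow> (real \<Rightarrow> real) \<Rightarrow> real \<Rightarrow> real" where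
  "biheat t f x = integral UNIV (\<lambda>y. Gbh_t t (x - y) * f y)"

definition phiAB :: "real \<Rightarrow> real \<Rightarrow> real \<Rightarrow> real" where
  "phiAB A B y = (if y \<ge> 0 then A * y else - B * y)"

definition alphaN :: "real \<Rightarrow> real" where
  "alphaN w = 1 - 1 / (1 + w\<^sup>2)\<^sup>2"

definition FN :: "real \<Rightarrow> real \<Rightarrow> real" where
  "FN w wx = 3 * w * wx\<^sup>2 / (1 + w\<^sup>2) ^ 3"

definition dx :: "(real \<Rightarrow> real \<Rightarrow> real) \<Rightarrow> real \<Rightarrow> real \<Rightarrow> real" where
  "dx u x t = deriv (\<lambda>y. u y t) x"

definition Nl :: "(real \<Rightarrow> real \<Rightarrow> real) \<Rightarrow> real \<Rightarrow> real \<Rightarrow> real" where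
  "Nl v x s = alphaN (v x s) * dx (dx v) x s + FN (v x s) (dx v x s)"

end

theory Submission
  imports Defs "HOL-Probability.Probability"
begin

text \<open>
  Gaussian regularization proves Fourier inversion, which gives the semigroup law. Since
  \<open>x\<^sup>n G\<^bsup>(j)\<^esup>\<close> is again a Fourier integral of a polynomial times \<open>exp (- \<xi>\<^sup>4)\<close>, every moment
  of \<open>G\<^bsup>(j)\<^esup>\<close> is, up to a phase factor, the value of that polynomial at \<open>\<xi> = 0\<close>; those of \<open>G\<close> up to
  order 4 are \<open>1, 0, 0, 0, -24\<close>.
  Differentiating under the integrals, \<open>U\<^sub>x\<close> is the right-hand side of the mild equation, so
  \<open>U\<^sub>x = v\<close>. The semigroup law lets the formula for \<open>U\<close> be restarted at any time \<open>t \<ge> 0\<close>: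
  \<open>U(t + h)\<close> is the biharmonic flow of \<open>U(t)\<close> over time \<open>h\<close> plus a Duhamel integral over
  \<open>(t, t + h)\<close>. As \<open>U(t)\<close> is Lipschitz uniformly in \<open>t\<close>, \<open>U\<close> moves by at most a multiple of
  \<open>h\<^bsup>1/4\<^esup>\<close>, which gives uniform continuity up to \<open>t = 0\<close>.
  Self-similarity \<open>U(x,t) = t\<^bsup>1/4\<^esup> U(x t\<^bsup>-1/4\<^esup>, 1)\<close> makes \<open>U\<close> differentiable in time, so it
  suffices to compute the right derivative from the restarted formula: Taylor expansion and the
  moments give \<open>-v\<^sub>x\<^sub>x\<^sub>x\<close> for the flow and the \<open>x\<close>-derivative of the nonlinearity for the Duhamel
  integral.
\<close>

section \<open>Integrals over the line\<close>

lemma integrable_inverse_one_plus_square: "integrable lborel (\<lambda>x::real. 1 / (1 + x\<^sup>2))"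
  using integrable_inverse_1_plus_square
  by (simp add: set_integrable_def einterval_eq_UNIV inverse_eq_divide)

lemma integrable_if_quadratic_decay:
  fixes f :: "real \<Rightarrow> real"
  assumes [measurable]: "f \<in> borel_measurable borel"
    and decay: "\<And>x. (1 + x\<^sup>2) * \<bar>f x\<bar> \<le> C"
  shows "integrable lborel f"
proof (rule Bochner_Integration.integrable_bound)
  show "integrable lborel (\<lambda>x::real. C * (1 / (1 + x\<^sup>2)))"
    by (intro integrable_mult_right integrable_inverse_one_plus_square)
  have "\<bar>f x\<bar> \<le> C * (1 / (1 + x\<^sup>2))" for x
    using decay[of x] by (simp add: pos_le_divide_eq add_pos_nonneg mult.commute)
  then show "AE x in lborel. norm (f x) \<le> norm (C * (1 / (1 + x\<^sup>2)))"
    by (intro AE_I2) (metis abs_ge_self order_trans real_norm_def)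
qed simp

lemma tendsto_0_at_infinity_if_linear_decay:
  fixes F :: "real \<Rightarrow> real"
  assumes "\<And>x. \<bar>x\<bar> * \<bar>F x\<bar> \<le> C"
  shows "(F \<longlongrightarrow> 0) at_infinity"
proof (rule Lim_null_comparison)
  show "\<forall>\<^sub>F x in at_infinity. norm (F x) \<le> C * \<bar>inverse x\<bar>"
    using eventually_not_equal_at_infinity[of "0::real"]
    by eventually_elim (use assms in \<open>simp add: field_simps\<close>)
  show "((\<lambda>x::real. C * \<bar>inverse x\<bar>) \<longlongrightarrow> 0) at_infinity"
    by (intro tendsto_mult_right_zero tendsto_rabs_zero tendsto_inverse_0)
qed

lemma integral_derivative_whole_line_eq_0:
  fixes F f :: "real \<Rightarrow> real"
  assumes deriv: "\<And>x. (F has_real_derivative f x) (at x)" and cont: "\<And>x. isCont f x"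
    and int: "integrable lborel f" and lim: "(F \<longlongrightarrow> 0) at_infinity"
  shows "(\<integral>x. f x \<partial>lborel) = 0"
proof -
  have "(LBINT x=-\<infinity>..\<infinity>. f x) = 0 - 0"
  proof (rule interval_integral_FTC_integrable)
    show "set_integrable lborel (einterval (- \<infinity>) \<infinity>) f"
      using int by (simp add: set_integrable_def einterval_eq_UNIV)
    show "((F \<circ> real_of_ereal) \<longlongrightarrow> 0) (at_right (-\<infinity>))"
      using tendsto_mono[OF at_bot_le_at_infinity lim]
      by (simp add: at_right_MInf filterlim_filtermap o_def)
    show "((F \<circ> real_of_ereal) \<longlongrightarrow> 0) (at_left \<infinity>)"
      using tendsto_mono[OF at_top_le_at_infinity lim]
      by (simp add: at_left_PInf filterlim_filtermap o_def)
  qed (use deriv cont in \<open>auto simp: has_real_derivative_iff_has_vector_derivative\<close>)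
  then show ?thesis
    by (simp add: interval_lebesgue_integral_def einterval_eq_UNIV set_lebesgue_integral_def)
qed

lemma integral_dominated_convergence_at:
  fixes s :: "'b::first_countable_topology \<Rightarrow> 'a \<Rightarrow> 'c::{banach, second_countable_topology}"
    and w :: "'a \<Rightarrow> real"
  assumes f: "f \<in> borel_measurable M" and w: "integrable M w"
    and meas: "\<forall>\<^sub>F t in at a within S. s t \<in> borel_measurable M"
    and lim: "AE x in M. ((\<lambda>t. s t x) \<longlongrightarrow> f x) (at a within S)"
    and bound: "\<forall>\<^sub>F t in at a within S. AE x in M. norm (s t x) \<le> w x"
  shows "((\<lambda>t. \<integral>x. s t x \<partial>M) \<longlongrightarrow> (\<integral>x. f x \<partial>M)) (at a within S)"
  unfolding tendsto_at_iff_sequentially comp_def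
proof (intro allI impI)
  fix X :: "nat \<Rightarrow> 'b"
  assume "\<forall>i. X i \<in> S - {a}" "X \<longlonglongrightarrow> a"
  then have X: "filterlim X (at a within S) sequentially"
    by (auto simp: filterlim_at)
  from filterlim_iff[THEN iffD1, OF X, rule_format, OF eventually_conj[OF meas bound]]
  obtain n0 where n0: "s (X n) \<in> borel_measurable M" "AE x in M. norm (s (X n) x) \<le> w x"
    if "n0 \<le> n" for n
    by (auto simp: eventually_sequentially)
  show "(\<lambda>n. \<integral>x. s (X n) x \<partial>M) \<longlonglongrightarrow> (\<integral>x. f x \<partial>M)"
  proof (rule LIMSEQ_offset, rule integral_dominated_convergence[OF f _ w])
    show "AE x in M. (\<lambda>n. s (X (n + n0)) x) \<longlonglongrightarrow> f x"
      using lim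
    proof eventually_elim
      case (elim x)
      from filterlim_compose[OF elim X] show ?case by (rule LIMSEQ_ignore_initial_segment)
    qed
  qed (use n0 in auto)
qed

lemma has_real_derivative_integral_Lipschitz:
  fixes f :: "real \<Rightarrow> 'a \<Rightarrow> real"
  assumes d: "d > 0" and int: "\<And>x. \<bar>x - a\<bar> < d \<Longrightarrow> integrable M (f x)"
    and deriv: "AE y in M. ((\<lambda>x. f x y) has_real_derivative f' y) (at a)"
    and Lipschitz: "\<And>x y. y \<in> space M \<Longrightarrow> \<bar>x - a\<bar> < d \<Longrightarrow> \<bar>f x y - f a y\<bar> \<le> g y * \<bar>x - a\<bar>"
    and g: "integrable M g" and f': "f' \<in> borel_measurable M"
  shows "((\<lambda>x. \<integral>y. f x y \<partial>M) has_real_derivative (\<integral>y. f' y \<partial>M)) (at a)"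
proof -
  have near: "\<forall>\<^sub>F x in at a. x \<noteq> a \<and> \<bar>x - a\<bar> < d"
    using d by (auto simp: eventually_at dist_real_def)
  have int_a: "integrable M (f a)" using int[of a] d by simp
  have "((\<lambda>x. \<integral>y. (f x y - f a y) / (x - a) \<partial>M) \<longlongrightarrow> (\<integral>y. f' y \<partial>M)) (at a)"
  proof (rule integral_dominated_convergence_at[OF f' g])
    show "\<forall>\<^sub>F x in at a. (\<lambda>y. (f x y - f a y) / (x - a)) \<in> borel_measurable M"
      using near by eventually_elim (use int int_a in auto)
    show "\<forall>\<^sub>F x in at a. AE y in M. norm ((f x y - f a y) / (x - a)) \<le> g y"
      using near by eventually_elim (use Lipschitz in \<open>auto simp: pos_divide_le_eq\<close>)
  qed (use deriv in \<open>simp add: has_field_derivative_iff\<close>)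
  moreover have "\<forall>\<^sub>F x in at a. (\<integral>y. (f x y - f a y) / (x - a) \<partial>M)
      = ((\<integral>y. f x y \<partial>M) - (\<integral>y. f a y \<partial>M)) / (x - a)"
    using near by eventually_elim (use int int_a in simp)
  ultimately show ?thesis
    unfolding has_field_derivative_iff by (rule Lim_transform_eventually)
qed

lemma has_real_derivative_integral:
  fixes f :: "real \<Rightarrow> 'a \<Rightarrow> real"
  assumes d: "d > 0" and int: "\<And>x. \<bar>x - a\<bar> < d \<Longrightarrow> integrable M (f x)"
    and deriv: "\<And>x y. y \<in> space M \<Longrightarrow> \<bar>x - a\<bar> < d \<Longrightarrow> ((\<lambda>x. f x y) has_real_derivative f' x y) (at x)"
    and bound: "\<And>x y. y \<in> space M \<Longrightarrow> \<bar>x - a\<bar> < d \<Longrightarrow> \<bar>f' x y\<bar> \<le> g y"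
    and g: "integrable M g" and f': "f' a \<in> borel_measurable M"
  shows "((\<lambda>x. \<integral>y. f x y \<partial>M) has_real_derivative (\<integral>y. f' a y \<partial>M)) (at a)"
proof (rule has_real_derivative_integral_Lipschitz[OF d int _ _ g f'])
  show "AE y in M. ((\<lambda>x. f x y) has_real_derivative f' a y) (at a)"
    using deriv d by auto
  fix x y assume y: "y \<in> space M" and x: "\<bar>x - a\<bar> < d"
  have ball: "z \<in> ball a d \<longleftrightarrow> \<bar>z - a\<bar> < d" for z
    by (auto simp: dist_real_def abs_minus_commute)
  have "norm (f x y - f a y) \<le> g y * norm (x - a)"
    by (rule field_differentiable_bound[where S="ball a d" and f'="\<lambda>x. f' x y"])
       (use x d deriv[OF y] bound[OF y] in \<open>auto simp: ball simp
           del: mem_ball intro: has_field_derivative_at_within\<close>)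
  then show "\<bar>f x y - f a y\<bar> \<le> g y * \<bar>x - a\<bar>" by simp
qed auto

lemma DERIV_eq_right_limit:
  fixes f :: "real \<Rightarrow> real"
  assumes "(f has_real_derivative D) (at t)" "((\<lambda>h. (f (t + h) - f t) / h) \<longlongrightarrow> R) (at_right 0)"
  shows "D = R"
proof (rule tendsto_unique[OF trivial_limit_at_right_real _ assms(2)])
  show "((\<lambda>h. (f (t + h) - f t) / h) \<longlongrightarrow> D) (at_right 0)"
    using assms(1) unfolding DERIV_def by (rule filterlim_mono[OF _ order_refl at_le]) simp
qed

lemma Fubini_dominated:
  fixes f b :: "real \<Rightarrow> real \<Rightarrow> real"
  assumes a: "integrable lborel a" and b: "\<And>x. integrable lborel (b x)"
    and b_mass: "\<And>x. (\<integral>y. \<bar>b x y\<bar> \<partial>lborel) \<le> B"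
    and meas [measurable]: "case_prod f \<in> borel_measurable (borel \<Otimes>\<^sub>M borel)"
    and dom: "\<And>x y. \<bar>f x y\<bar> \<le> \<bar>a x\<bar> * \<bar>b x y\<bar>"
  shows "(\<integral>x. \<integral>y. f x y \<partial>lborel \<partial>lborel) = (\<integral>y. \<integral>x. f x y \<partial>lborel \<partial>lborel)"
proof -
  have slice: "integrable lborel (f x)" for x
    by (rule Bochner_Integration.integrable_bound[OF integrable_mult_right[OF b[of x], of "a x"]])
       (auto simp: abs_mult intro!: dom)
  have "integrable (lborel \<Otimes>\<^sub>M lborel) (case_prod f)"
  proof (rule lborel_pair.Fubini_integrable)
    have "(\<integral>y. \<bar>f x y\<bar> \<partial>lborel) \<le> \<bar>a x\<bar> * B" for x
    proof -
      have "(\<integral>y. \<bar>f x y\<bar> \<partial>lborel) \<le> (\<integral>y. \<bar>a x\<bar> * \<bar>b x y\<bar> \<partial>lborel)"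
        by (intro integral_mono integrable_abs slice integrable_mult_right b dom)
      also have "\<dots> \<le> \<bar>a x\<bar> * B"
        unfolding integral_mult_right_zero by (intro mult_left_mono b_mass) simp
      finally show ?thesis .
    qed
    moreover have "0 \<le> (\<integral>y. \<bar>f x y\<bar> \<partial>lborel)" for x
      by (rule Bochner_Integration.integral_nonneg) simp
    ultimately have "AE x in lborel. norm (\<integral>y. \<bar>f x y\<bar> \<partial>lborel) \<le> norm (\<bar>a x\<bar> * B)"
      by (intro AE_I2) (auto intro: order_trans[OF _ abs_ge_self])
    then have "integrable lborel (\<lambda>x. \<integral>y. \<bar>f x y\<bar> \<partial>lborel)"
      by (rule Bochner_Integration.integrable_bound
          [OF integrable_mult_left[OF integrable_abs[OF a]], rotated]) simp
    then show "integrable lborel (\<lambda>x. \<integral>y. norm (case (x, y) of (x, y) \<Rightarrow> f x y) \<partial>lborel)"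
      by (simp only: prod.case real_norm_def)
  qed (use slice in auto)
  from lborel_pair.Fubini_integral[OF this] show ?thesis by simp
qed

lemma Fubini_bounded_kernel:
  fixes a b :: "real \<Rightarrow> real" and c :: "real \<Rightarrow> real \<Rightarrow> real"
  assumes a: "integrable lborel a" and b: "integrable lborel b"
    and [measurable]: "case_prod c \<in> borel_measurable (borel \<Otimes>\<^sub>M borel)"
    and bound: "\<And>x y. \<bar>c x y\<bar> \<le> 1"
  shows "(\<integral>x. a x * (\<integral>y. b y * c x y \<partial>lborel) \<partial>lborel)
      = (\<integral>y. b y * (\<integral>x. a x * c x y \<partial>lborel) \<partial>lborel)"
proof -
  have [measurable]: "a \<in> borel_measurable borel" "b \<in> borel_measurable borel" using a b by auto
  have "(\<integral>x. \<integral>y. a x * (b y * c x y) \<partial>lborel \<partial>lborel)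
      = (\<integral>y. \<integral>x. a x * (b y * c x y) \<partial>lborel \<partial>lborel)"
    by (rule Fubini_dominated[OF a b order_refl])
       (auto simp: abs_mult intro!: mult_left_mono mult_left_le bound)
  moreover have "(\<integral>x. a x * (b y * c x y) \<partial>lborel) = b y * (\<integral>x. a x * c x y \<partial>lborel)" for y
    by (subst integral_mult_right_zero[symmetric]) (simp only: mult.left_commute)
  ultimately show ?thesis by (simp only: integral_mult_right_zero)
qed

section \<open>Fourier inversion\<close>

text \<open>The real part of \<open>e\<^bsup>i\<theta>\<^esup> \<integral> f(\<xi>) e\<^bsup>ix\<xi>\<^esup> d\<xi>\<close>: the phase covers cosine and sine integrals at once.\<close>
definition fourier_phase :: "(real \<Rightarrow> real) \<Rightarrow> real \<Rightarrow> real \<Rightarrow> real" where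
  "fourier_phase f \<theta> x = (\<integral>\<xi>. f \<xi> * cos (x * \<xi> + \<theta>) \<partial>lborel)"

lemma integrable_mult_cos:
  fixes f :: "real \<Rightarrow> real"
  assumes "integrable lborel f" shows "integrable lborel (\<lambda>\<xi>. f \<xi> * cos (x * \<xi> + \<theta>))"
  by (rule Bochner_Integration.integrable_bound[OF assms])
     (use assms in \<open>auto simp: abs_mult intro!: mult_left_le\<close>)

lemma abs_fourier_phase_le:
  assumes "integrable lborel f" shows "\<bar>fourier_phase f \<theta> x\<bar> \<le> (\<integral>\<xi>. \<bar>f \<xi>\<bar> \<partial>lborel)"
  using Bochner_Integration.integral_norm_bound_integral
    [OF integrable_mult_cos[OF assms, of x \<theta>] integrable_abs[OF assms]]
  by (simp add: fourier_phase_def abs_mult mult_left_le)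

lemma fourier_phase_even:
  assumes f: "integrable lborel f" and even: "\<And>\<xi>. f (- \<xi>) = f \<xi>"
  shows "fourier_phase f \<theta> x = cos \<theta> * fourier_phase f 0 x"
proof -
  have reflect: "fourier_phase f \<theta> x = fourier_phase f (- \<theta>) x" for \<theta>
  proof -
    have "fourier_phase f \<theta> x = \<bar>-1\<bar> *\<^sub>R (\<integral>\<xi>. f (0 + -1 * \<xi>) * cos (x * (0 + -1 * \<xi>) + \<theta>) \<partial>lborel)"
      unfolding fourier_phase_def by (rule lborel_integral_real_affine) simp
    also have "\<dots> = fourier_phase f (- \<theta>) x"
      using cos_minus[of "x * \<xi> - \<theta>" for \<xi>] by (simp add: fourier_phase_def even)
    finally show ?thesis .
  qed
  have "2 * fourier_phase f \<theta> x = (\<integral>\<xi>. f \<xi> * cos (x * \<xi> + \<theta>) + f \<xi> * cos (x * \<xi> + - \<theta>) \<partial>lborel)"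
    using reflect[of \<theta>]
    by (simp add: integrable_mult_cos[OF f] fourier_phase_def del: add_uminus_conv_diff)
  also have "\<dots> = 2 * (cos \<theta> * fourier_phase f 0 x)"
    unfolding fourier_phase_def integral_mult_right_zero[symmetric]
    by (intro Bochner_Integration.integral_cong refl) (simp add: cos_add cos_diff algebra_simps)
  finally show ?thesis by simp
qed

lemma fourier_phase_deriv:
  assumes f: "integrable lborel f" and \<xi>f: "integrable lborel (\<lambda>\<xi>. \<xi> * f \<xi>)"
  shows "(fourier_phase f \<theta> has_real_derivative fourier_phase (\<lambda>\<xi>. \<xi> * f \<xi>) (\<theta> + pi / 2) x) (at x)"
  unfolding fourier_phase_def[abs_def]
proof (rule has_real_derivative_integral[where d=1, OF _ integrable_mult_cos[OF f] _ _
    integrable_abs[OF \<xi>f]])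
  show "(\<lambda>\<xi>. \<xi> * f \<xi> * cos (x * \<xi> + (\<theta> + pi / 2))) \<in> borel_measurable lborel"
    using integrable_mult_cos[OF \<xi>f] by (rule borel_measurable_integrable)
  fix x \<xi> :: real
  show "((\<lambda>x. f \<xi> * cos (x * \<xi> + \<theta>))
      has_real_derivative \<xi> * f \<xi> * cos (x * \<xi> + (\<theta> + pi / 2))) (at x)"
    by (auto intro!: derivative_eq_intros simp: cos_add sin_add algebra_simps)
  show "\<bar>\<xi> * f \<xi> * cos (x * \<xi> + (\<theta> + pi / 2))\<bar> \<le> \<bar>\<xi> * f \<xi>\<bar>"
    unfolding abs_mult[of "\<xi> * f \<xi>"] by (intro mult_left_le) auto
qed simp

lemma mult_fourier_phase:
  assumes deriv: "\<And>\<xi>. (f has_real_derivative f' \<xi>) (at \<xi>)" and cont: "\<And>\<xi>. isCont f' \<xi>"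
    and f: "integrable lborel f" and f': "integrable lborel f'" and lim: "(f \<longlongrightarrow> 0) at_infinity"
  shows "x * fourier_phase f \<theta> x = fourier_phase f' (\<theta> + pi / 2) x"
proof -
  have "(\<integral>\<xi>. x * (f \<xi> * cos (x * \<xi> + \<theta>)) - f' \<xi> * cos (x * \<xi> + (\<theta> + pi / 2)) \<partial>lborel) = 0"
  proof (rule integral_derivative_whole_line_eq_0[where F="\<lambda>\<xi>. f \<xi> * sin (x * \<xi> + \<theta>)"])
    fix \<xi> :: real
    show "((\<lambda>\<xi>. f \<xi> * sin (x * \<xi> + \<theta>)) has_real_derivative
        x * (f \<xi> * cos (x * \<xi> + \<theta>)) - f' \<xi> * cos (x * \<xi> + (\<theta> + pi / 2))) (at \<xi>)"
      by (auto intro!: derivative_eq_intros deriv simp: cos_add sin_add algebra_simps)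
    show "isCont (\<lambda>\<xi>. x * (f \<xi> * cos (x * \<xi> + \<theta>)) - f' \<xi> * cos (x * \<xi> + (\<theta> + pi / 2))) \<xi>"
      by (intro continuous_intros cont DERIV_isCont[OF deriv])
  next
    have "norm (f \<xi> * sin (x * \<xi> + \<theta>)) \<le> norm (f \<xi>)" for \<xi>
      by (simp add: abs_mult mult_left_le)
    then show "((\<lambda>\<xi>. f \<xi> * sin (x * \<xi> + \<theta>)) \<longlongrightarrow> 0) at_infinity"
      by (intro Lim_null_comparison[OF always_eventually tendsto_norm_zero[OF lim]]) simp
  qed (intro Bochner_Integration.integrable_diff integrable_mult_right integrable_mult_cos f f')
  then show ?thesis
    using integrable_mult_cos[OF f] integrable_mult_cos[OF f'] by (simp add: fourier_phase_def)
qed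

lemma fourier_phase_scaled:
  assumes "c > 0" shows "fourier_phase (\<lambda>\<xi>. f (c * \<xi>)) \<theta> x = fourier_phase f \<theta> (x / c) / c"
proof -
  have "fourier_phase f \<theta> (x / c)
      = \<bar>c\<bar> *\<^sub>R (\<integral>\<xi>. f (0 + c * \<xi>) * cos (x / c * (0 + c * \<xi>) + \<theta>) \<partial>lborel)"
    unfolding fourier_phase_def by (rule lborel_integral_real_affine) (use assms in simp)
  then show ?thesis using assms by (simp add: fourier_phase_def)
qed

lemma integral_mult_fourier_phase_commute:
  assumes "integrable lborel f" "integrable lborel g"
  shows "(\<integral>x. f x * fourier_phase g \<theta> x \<partial>lborel) = (\<integral>y. g y * fourier_phase f \<theta> y \<partial>lborel)"
  using Fubini_bounded_kernel[OF assms, of "\<lambda>x y. cos (x * y + \<theta>)"]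
  by (simp add: fourier_phase_def mult.commute)

lemma integrable_std_normal_density: "integrable lborel std_normal_density"
  using integrable_normal_density[of 1 0] by simp

lemma fourier_phase_std_normal: "fourier_phase std_normal_density \<theta> x = cos \<theta> * exp (- (x\<^sup>2) / 2)"
proof -
  have int: "integrable lborel (\<lambda>\<xi>. std_normal_density \<xi> *\<^sub>R iexp (x * \<xi>))"
    by (rule Bochner_Integration.integrable_bound[OF integrable_std_normal_density]) auto
  have "(\<integral>\<xi>. std_normal_density \<xi> *\<^sub>R iexp (x * \<xi>) \<partial>lborel) = complex_of_real (exp (- (x\<^sup>2) / 2))"
    using char_std_normal_distribution[THEN fun_cong, of x]
    by (simp add: char_def integral_density)
  then have "cos \<theta> * exp (- (x\<^sup>2) / 2)
      = Re (iexp \<theta> * (\<integral>\<xi>. std_normal_density \<xi> *\<^sub>R iexp (x * \<xi>) \<partial>lborel))"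
    by (simp add: Re_exp)
  also have "\<dots> = (\<integral>\<xi>. Re (iexp \<theta> * (std_normal_density \<xi> *\<^sub>R iexp (x * \<xi>))) \<partial>lborel)"
    unfolding integral_mult_right_zero[symmetric]
    by (intro integral_Re[symmetric] integrable_mult_right int)
  also have "\<dots> = fourier_phase std_normal_density \<theta> x"
    by (simp add: fourier_phase_def Re_exp Im_exp cos_add algebra_simps)
  finally show ?thesis by simp
qed

lemma integral_fourier_phase_mollified:
  assumes e: "e > 0" and f: "integrable lborel f"
  shows "(\<integral>x. std_normal_density (e * x) * fourier_phase f \<theta> x \<partial>lborel)
    = cos \<theta> * sqrt (2 * pi) * (\<integral>u. std_normal_density u * f (e * u) \<partial>lborel)"
proof -
  have transform: "fourier_phase (\<lambda>x. std_normal_density (e * x)) \<theta> \<xi>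
      = cos \<theta> * sqrt (2 * pi) / e * std_normal_density (\<xi> / e)" for \<xi>
    unfolding fourier_phase_scaled[OF e] fourier_phase_std_normal
    by (simp add: std_normal_density_def)
  have "integrable lborel (\<lambda>x. std_normal_density (e * x))"
    using lborel_integrable_real_affine[OF integrable_std_normal_density, of e 0] e by simp
  from integral_mult_fourier_phase_commute[OF this f, of \<theta>]
  have "(\<integral>x. std_normal_density (e * x) * fourier_phase f \<theta> x \<partial>lborel)
      = (\<integral>\<xi>. f \<xi> * (cos \<theta> * sqrt (2 * pi) / e * std_normal_density (\<xi> / e)) \<partial>lborel)"
    unfolding transform .
  also have "\<dots> = \<bar>e\<bar> *\<^sub>R (\<integral>u. f (0 + e * u)
      * (cos \<theta> * sqrt (2 * pi) / e * std_normal_density ((0 + e * u) / e)) \<partial>lborel)"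
    by (rule lborel_integral_real_affine) (use e in simp)
  also have "\<dots> = (\<integral>u. cos \<theta> * sqrt (2 * pi) * (std_normal_density u * f (e * u)) \<partial>lborel)"
    unfolding real_scaleR_def integral_mult_right_zero[symmetric]
    by (intro Bochner_Integration.integral_cong refl) (use e in simp)
  finally show ?thesis by simp
qed


lemma std_normal_approximate_identity:
  fixes f :: "real \<Rightarrow> real"
  assumes [measurable]: "f \<in> borel_measurable borel"
    and bounded: "\<And>\<xi>. \<bar>f \<xi>\<bar> \<le> B" and cont: "isCont f 0"
  shows "((\<lambda>e. \<integral>u. std_normal_density u * f (e * u) \<partial>lborel) \<longlongrightarrow> f 0) (at_right 0)"
proof -
  have "((\<lambda>e. \<integral>u. std_normal_density u * f (e * u) \<partial>lborel)
      \<longlongrightarrow> (\<integral>u. std_normal_density u * f 0 \<partial>lborel)) (at_right 0)"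
  proof (rule integral_dominated_convergence_at)
    show "integrable lborel (\<lambda>u. std_normal_density u * B)"
      using integrable_std_normal_density by simp
    show "AE u in lborel. ((\<lambda>e. std_normal_density u * f (e * u))
        \<longlongrightarrow> std_normal_density u * f 0) (at_right 0)"
      by (intro AE_I2 tendsto_mult_left isCont_tendsto_compose[OF cont] tendsto_mult_left_zero
          tendsto_ident_at)
    show "\<forall>\<^sub>F e in at_right 0. AE u in lborel. norm (std_normal_density u * f (e * u))
        \<le> std_normal_density u * B"
      using bounded by (intro always_eventually allI AE_I2) (simp add: abs_mult mult_left_mono)
  qed auto
  then show ?thesis by simp
qed

lemma tendsto_integral_std_normal_cutoff:
  fixes F :: "real \<Rightarrow> real"
  assumes F: "integrable lborel F"
  shows "((\<lambda>e. \<integral>x. std_normal_density (e * x) * F x \<partial>lborel)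
      \<longlongrightarrow> (\<integral>x. F x \<partial>lborel) / sqrt (2 * pi)) (at_right 0)"
proof -
  have [measurable]: "F \<in> borel_measurable borel" using F by auto
  have cont: "isCont std_normal_density 0"
    unfolding std_normal_density_def[abs_def] by (intro continuous_intros) auto
  have le_1: "std_normal_density x \<le> 1" for x
    using pi_gt3 real_sqrt_ge_one[of "2 * pi"]
    by (auto simp: std_normal_density_def intro: order_trans[of _ 1])
  have "((\<lambda>e. \<integral>x. std_normal_density (e * x) * F x \<partial>lborel)
      \<longlongrightarrow> (\<integral>x. std_normal_density 0 * F x \<partial>lborel)) (at_right 0)"
  proof (rule integral_dominated_convergence_at[OF _ integrable_abs[OF F]])
    show "AE x in lborel. ((\<lambda>e. std_normal_density (e * x) * F x)
        \<longlongrightarrow> std_normal_density 0 * F x) (at_right 0)"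
      by (intro AE_I2 tendsto_mult_right isCont_tendsto_compose[OF cont] tendsto_mult_left_zero
          tendsto_ident_at)
    show "\<forall>\<^sub>F e in at_right 0. AE x in lborel. norm (std_normal_density (e * x) * F x) \<le> \<bar>F x\<bar>"
      using le_1 by (intro always_eventually allI AE_I2) (simp add: abs_mult mult_left_le_one_le)
  qed auto
  then show ?thesis by (simp add: std_normal_density_def)
qed

lemma integral_fourier_phase:
  assumes f: "integrable lborel f" and bounded: "\<And>\<xi>. \<bar>f \<xi>\<bar> \<le> B" and cont: "isCont f 0"
    and F: "integrable lborel (fourier_phase f \<theta>)"
  shows "(\<integral>x. fourier_phase f \<theta> x \<partial>lborel) = 2 * pi * cos \<theta> * f 0"
proof -
  have "((\<lambda>e. cos \<theta> * sqrt (2 * pi) * (\<integral>u. std_normal_density u * f (e * u) \<partial>lborel))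
      \<longlongrightarrow> cos \<theta> * sqrt (2 * pi) * f 0) (at_right 0)"
    using f by (intro tendsto_mult_left std_normal_approximate_identity[OF _ bounded cont]) auto
  then have "((\<lambda>e. \<integral>x. std_normal_density (e * x) * fourier_phase f \<theta> x \<partial>lborel)
      \<longlongrightarrow> cos \<theta> * sqrt (2 * pi) * f 0) (at_right 0)"
    by (rule Lim_transform_eventually)
       (use integral_fourier_phase_mollified[OF _ f] in
           \<open>auto intro: eventually_mono[OF eventually_at_right_less]\<close>)
  with tendsto_integral_std_normal_cutoff[OF F]
  have "(\<integral>x. fourier_phase f \<theta> x \<partial>lborel) / sqrt (2 * pi) = cos \<theta> * sqrt (2 * pi) * f 0"
    by (rule tendsto_unique[OF trivial_limit_at_right_real])
  then show ?thesis by (simp add: field_simps)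
qed

lemma fourier_inversion_cos:
  assumes f: "integrable lborel f" and bounded: "\<And>\<xi>. \<bar>f \<xi>\<bar> \<le> B" and cont: "\<And>\<xi>. isCont f \<xi>"
    and F: "integrable lborel (fourier_phase f \<theta>)"
  shows "(\<integral>x. fourier_phase f \<theta> x * cos (x * z) \<partial>lborel) = pi * cos \<theta> * (f z + f (- z))"
proof -
  define f_z where "f_z \<xi> = (f (z + \<xi>) + f (- z + \<xi>)) / 2" for \<xi>
  have shift: "integrable lborel (\<lambda>\<xi>. f (c + \<xi>))"
    "(\<integral>\<xi>. f (c + \<xi>) * cos (x * \<xi> + \<theta>) \<partial>lborel)
        = (\<integral>\<xi>. f \<xi> * cos (x * \<xi> + (\<theta> - x * c)) \<partial>lborel)" for c x
    using lborel_integrable_real_affine[OF f, of 1 c]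
      lborel_integral_real_affine[of 1 "\<lambda>\<xi>. f \<xi> * cos (x * \<xi> + (\<theta> - x * c))" c]
    by (simp_all add: algebra_simps)
  have transform: "fourier_phase f_z \<theta> x = fourier_phase f \<theta> x * cos (x * z)" for x
  proof -
    have "fourier_phase f_z \<theta> x
        = (\<integral>\<xi>. (f (z + \<xi>) * cos (x * \<xi> + \<theta>) + f (- z + \<xi>) * cos (x * \<xi> + \<theta>)) / 2 \<partial>lborel)"
      unfolding fourier_phase_def f_z_def
      by (intro Bochner_Integration.integral_cong refl) (simp add: algebra_simps)
    also have "\<dots> = ((\<integral>\<xi>. f \<xi> * cos (x * \<xi> + (\<theta> - x * z)) \<partial>lborel)
        + (\<integral>\<xi>. f \<xi> * cos (x * \<xi> + (\<theta> - x * - z)) \<partial>lborel)) / 2"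
      unfolding shift(2)[symmetric] using integrable_mult_cos[OF shift(1)]
      by (simp del: add_divide_distrib uminus_add_conv_diff)
    also have "\<dots> = (\<integral>\<xi>. (f \<xi> * cos (x * \<xi> + (\<theta> - x * z))
        + f \<xi> * cos (x * \<xi> + (\<theta> - x * - z))) / 2 \<partial>lborel)"
      using integrable_mult_cos[OF f] by (simp del: add_divide_distrib)
    also have "\<dots> = (\<integral>\<xi>. f \<xi> * cos (x * \<xi> + \<theta>) * cos (x * z) \<partial>lborel)"
      by (intro Bochner_Integration.integral_cong refl)
         (simp add: cos_add cos_diff sin_diff sin_add field_simps)
    finally show ?thesis by (simp add: fourier_phase_def)
  qed
  have "(\<integral>x. fourier_phase f_z \<theta> x \<partial>lborel) = 2 * pi * cos \<theta> * f_z 0"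
  proof (rule integral_fourier_phase)
    show "\<bar>f_z \<xi>\<bar> \<le> B" for \<xi>
      using bounded[of "z + \<xi>"] bounded[of "- z + \<xi>"] by (simp add: f_z_def)
    have "isCont (\<lambda>\<xi>. f (c + \<xi>)) 0" for c
      by (rule isCont_o2[OF _ cont]) (intro continuous_intros)
    then show "isCont f_z 0"
      unfolding f_z_def[abs_def]
      by (auto intro!: isCont_divide isCont_add simp del: uminus_add_conv_diff)
    show "integrable lborel (fourier_phase f_z \<theta>)"
      using integrable_mult_cos[OF F, of z 0] by (simp add: transform[abs_def] mult.commute[of z])
    show "integrable lborel f_z"
      using shift(1)[of z] shift(1)[of "- z"] by (simp add: f_z_def[abs_def])
  qed
  then show ?thesis by (simp add: transform f_z_def)
qed

section \<open>The biharmonic kernel\<close>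

lemma power_mult_exp_minus_le_fact:
  fixes x :: real assumes "0 \<le> x" shows "x ^ n * exp (- x) \<le> fact n"
proof -
  have "x ^ n /\<^sub>R fact n \<le> (\<Sum>k<Suc n. x ^ k /\<^sub>R fact k)"
    by (rule member_le_sum) (use assms in auto)
  also have "\<dots> \<le> exp x"
    unfolding exp_def by (rule sum_le_suminf[OF summable_exp_generic]) (use assms in auto)
  finally show ?thesis by (simp add: exp_minus field_simps)
qed

lemma abs_power_mult_exp_quartic_le: "\<bar>x::real\<bar> ^ n * exp (-(x ^ 4)) \<le> 1 + fact n"
proof -
  have "\<bar>x\<bar> ^ n \<le> 1 + (x ^ 4) ^ n"
  proof (cases "\<bar>x\<bar> \<le> 1")
    case True
    then show ?thesis using power_le_one[of "\<bar>x\<bar>" n] by (simp add: add_increasing2)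
  next
    case False
    then have "\<bar>x\<bar> ^ n \<le> \<bar>x\<bar> ^ (4 * n)" by (intro power_increasing) auto
    then show ?thesis by (simp add: power_mult)
  qed
  then have "\<bar>x\<bar> ^ n * exp (-(x ^ 4)) \<le> (1 + (x ^ 4) ^ n) * exp (-(x ^ 4))"
    by (intro mult_right_mono) auto
  also have "\<dots> \<le> 1 + fact n"
    using power_mult_exp_minus_le_fact[of "x ^ 4" n] by (simp add: distrib_right add_mono)
  finally show ?thesis .
qed

lemma poly_exp_quartic_bounded: "\<exists>C. \<forall>x::real. \<bar>poly p x * exp (-(x ^ 4))\<bar> \<le> C"
proof -
  have "\<bar>poly p x * exp (-(x ^ 4))\<bar> \<le> (\<Sum>i\<le>degree p. \<bar>coeff p i\<bar> * (1 + fact i))" for x :: real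
  proof -
    have "\<bar>poly p x * exp (-(x ^ 4))\<bar> \<le> (\<Sum>i\<le>degree p. \<bar>coeff p i * x ^ i\<bar>) * exp (-(x ^ 4))"
      unfolding abs_mult[of "poly p x"] abs_exp_cancel
      unfolding poly_altdef by (intro mult_right_mono sum_abs) auto
    also have "\<dots> = (\<Sum>i\<le>degree p. \<bar>coeff p i\<bar> * (\<bar>x\<bar> ^ i * exp (-(x ^ 4))))"
      by (simp add: sum_distrib_right abs_mult power_abs mult.assoc)
    also have "\<dots> \<le> (\<Sum>i\<le>degree p. \<bar>coeff p i\<bar> * (1 + fact i))"
      by (intro sum_mono mult_left_mono abs_power_mult_exp_quartic_le) auto
    finally show ?thesis .
  qed
  then show ?thesis by blast
qed

lemma integrable_poly_exp_quartic: "integrable lborel (\<lambda>x::real. poly p x * exp (-(x ^ 4)))"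
proof -
  obtain C where C: "\<bar>poly ([:1,0,1:] * p) x * exp (-(x ^ 4))\<bar> \<le> C" for x
    using poly_exp_quartic_bounded by metis
  have "(1 + x\<^sup>2) * \<bar>poly p x * exp (-(x ^ 4))\<bar> = \<bar>poly ([:1,0,1:] * p) x * exp (-(x ^ 4))\<bar>" for x
  proof -
    have "poly ([:1,0,1:] * p) x = (1 + x\<^sup>2) * poly p x"
      by (simp add: power2_eq_square algebra_simps)
    then show ?thesis by (simp only: abs_mult) (simp add: mult.assoc)
  qed
  moreover have "poly p \<in> borel_measurable borel"
    by (intro borel_measurable_continuous_onI continuous_intros)
  ultimately show ?thesis
    using C by (intro integrable_if_quadratic_decay[of _ C]) auto
qed

definition quartic_fourier :: "real poly \<Rightarrow> real \<Rightarrow> real \<Rightarrow> real" where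
  "quartic_fourier p = fourier_phase (\<lambda>\<xi>. poly p \<xi> * exp (-(\<xi> ^ 4)))"

definition quartic_pderiv :: "real poly \<Rightarrow> real poly" where
  "quartic_pderiv p = pderiv p - [:0,0,0,4:] * p"

lemma poly_exp_quartic_deriv:
  "((\<lambda>\<xi>. poly p \<xi> * exp (-(\<xi> ^ 4)))
      has_real_derivative poly (quartic_pderiv p) \<xi> * exp (-(\<xi> ^ 4))) (at \<xi>)"
  by (rule derivative_eq_intros poly_DERIV refl)+
     (simp add: quartic_pderiv_def power3_eq_cube algebra_simps)

lemma quartic_fourier_deriv:
  "(quartic_fourier p \<theta> has_real_derivative quartic_fourier ([:0,1:] * p) (\<theta> + pi / 2) x) (at x)"
  using fourier_phase_deriv[OF integrable_poly_exp_quartic, of p \<theta> x]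
    integrable_poly_exp_quartic[of "[:0,1:] * p"]
  by (simp add: quartic_fourier_def mult.assoc)

lemma mult_quartic_fourier: "x * quartic_fourier p \<theta> x
    = quartic_fourier (quartic_pderiv p) (\<theta> + pi / 2) x"
  unfolding quartic_fourier_def
proof (rule mult_fourier_phase[OF poly_exp_quartic_deriv _ integrable_poly_exp_quartic
    integrable_poly_exp_quartic])
  obtain C where "\<bar>poly ([:0,1:] * p) \<xi> * exp (-(\<xi> ^ 4))\<bar> \<le> C" for \<xi>
    using poly_exp_quartic_bounded by metis
  then show "((\<lambda>\<xi>. poly p \<xi> * exp (-(\<xi> ^ 4))) \<longlongrightarrow> 0) at_infinity"
    by (intro tendsto_0_at_infinity_if_linear_decay[of _ C]) (simp add: abs_mult mult.assoc)
qed (intro continuous_intros)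

lemma power_mult_quartic_fourier:
  "x ^ n * quartic_fourier p \<theta> x
      = quartic_fourier ((quartic_pderiv ^^ n) p) (\<theta> + real n * pi / 2) x"
proof (induction n arbitrary: p \<theta>)
  case (Suc n)
  have "x ^ Suc n * quartic_fourier p \<theta> x
      = x ^ n * quartic_fourier (quartic_pderiv p) (\<theta> + pi / 2) x"
    by (simp flip: mult_quartic_fourier)
  also have "\<dots> = quartic_fourier ((quartic_pderiv ^^ Suc n) p) (\<theta> + pi / 2 + real n * pi / 2) x"
    by (simp only: Suc funpow_Suc_right comp_apply)
  also have "\<theta> + pi / 2 + real n * pi / 2 = \<theta> + real (Suc n) * pi / 2"
    by (simp add: field_simps)
  finally show ?case .
qed simp

lemma quartic_fourier_decay: "\<exists>C. \<forall>x. \<bar>x\<bar> ^ n * \<bar>quartic_fourier p \<theta> x\<bar> \<le> C"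
proof -
  have "\<bar>x\<bar> ^ n * \<bar>quartic_fourier p \<theta> x\<bar>
      \<le> (\<integral>\<xi>. \<bar>poly ((quartic_pderiv ^^ n) p) \<xi> * exp (-(\<xi> ^ 4))\<bar> \<partial>lborel)" for x
    unfolding power_abs[symmetric] abs_mult[symmetric] power_mult_quartic_fourier
    unfolding quartic_fourier_def by (rule abs_fourier_phase_le[OF integrable_poly_exp_quartic])
  then show ?thesis by blast
qed

lemma borel_measurable_quartic_fourier [measurable]: "quartic_fourier p \<theta> \<in> borel_measurable borel"
  by (intro borel_measurable_continuous_onI continuous_at_imp_continuous_on ballI
      DERIV_isCont[OF quartic_fourier_deriv])

lemma integrable_quartic_fourier: "integrable lborel (quartic_fourier p \<theta>)"
proof -
  obtain C\<^sub>0 C\<^sub>2 where C: "\<bar>x\<bar> ^ 0 * \<bar>quartic_fourier p \<theta> x\<bar> \<le> C\<^sub>0"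
      "\<bar>x\<bar> ^ 2 * \<bar>quartic_fourier p \<theta> x\<bar> \<le> C\<^sub>2" for x
    using quartic_fourier_decay by metis
  show ?thesis
  proof (rule integrable_if_quadratic_decay)
    show "(1 + x\<^sup>2) * \<bar>quartic_fourier p \<theta> x\<bar> \<le> C\<^sub>0 + C\<^sub>2" for x
      using add_mono[OF C(1)[of x] C(2)[of x]] by (simp add: distrib_right)
  qed simp
qed

lemma integral_quartic_fourier: "(\<integral>x. quartic_fourier p \<theta> x \<partial>lborel) = 2 * pi * cos \<theta> * poly p 0"
proof -
  obtain B where "\<bar>poly p \<xi> * exp (-(\<xi> ^ 4))\<bar> \<le> B" for \<xi>
    using poly_exp_quartic_bounded by metis
  then show ?thesis
    using integral_fourier_phase[OF integrable_poly_exp_quartic _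
        DERIV_isCont[OF poly_exp_quartic_deriv], of p B \<theta>]
      integrable_quartic_fourier[of p \<theta>]
    by (simp add: quartic_fourier_def)
qed

definition Gbh_der :: "nat \<Rightarrow> real \<Rightarrow> real" where
  "Gbh_der j x = quartic_fourier (monom 1 j) (real j * pi / 2) x / (2 * pi)"

lemma Gbh_eq_Gbh_der: "Gbh = Gbh_der 0"
proof
  fix x :: real
  have "integral UNIV (\<lambda>\<xi>. exp (-(\<xi> ^ 4)) * cos (x * \<xi>))
      = (\<integral>\<xi>. exp (-(\<xi> ^ 4)) * cos (x * \<xi>) \<partial>lborel)"
    by (rule integral_lborel)
       (use integrable_mult_cos[OF integrable_poly_exp_quartic[of 1], of x 0] in simp)
  then show "Gbh x = Gbh_der 0 x"
    by (simp add: Gbh_def Gbh_der_def quartic_fourier_def fourier_phase_def monom_0)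
qed

lemma Gbh_der_deriv: "(Gbh_der j has_real_derivative Gbh_der (Suc j) x) (at x)"
proof -
  have phase: "real j * pi / 2 + pi / 2 = real (Suc j) * pi / 2" by (simp add: field_simps)
  show ?thesis
    unfolding Gbh_der_def[abs_def]
    using DERIV_cdivide[OF quartic_fourier_deriv[of "monom 1 j" "real j * pi / 2" x], of "2 * pi"]
    unfolding phase by (simp add: monom_Suc)
qed

lemma borel_measurable_Gbh_der [measurable]: "Gbh_der j \<in> borel_measurable borel"
  unfolding Gbh_der_def[abs_def] by measurable

lemma power_mult_Gbh_der:
  "x ^ n * Gbh_der j x = quartic_fourier ((quartic_pderiv ^^ n) (monom 1 j))
      (real (n + j) * pi / 2) x / (2 * pi)"
proof -
  have phase: "real j * pi / 2 + real n * pi / 2 = real (n + j) * pi / 2" by (simp add: field_simps)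
  show ?thesis
    unfolding Gbh_der_def times_divide_eq_right power_mult_quartic_fourier phase by (rule refl)
qed

lemma Gbh_der_decay: "\<exists>C. \<forall>x. \<bar>x\<bar> ^ n * \<bar>Gbh_der j x\<bar> \<le> C"
proof -
  obtain C where "\<bar>x\<bar> ^ n * \<bar>quartic_fourier (monom 1 j) (real j * pi / 2) x\<bar> \<le> C" for x
    using quartic_fourier_decay by metis
  then have "\<bar>x\<bar> ^ n * \<bar>Gbh_der j x\<bar> \<le> C / (2 * pi)" for x
    by (simp add: Gbh_der_def abs_mult divide_right_mono)
  then show ?thesis by blast
qed

lemma integrable_power_mult_Gbh_der: "integrable lborel (\<lambda>x. x ^ n * Gbh_der j x)"
  unfolding power_mult_Gbh_der using integrable_quartic_fourier by simp

lemma integrable_Gbh_der: "integrable lborel (Gbh_der j)"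
  using integrable_power_mult_Gbh_der[of 0 j] by simp

definition Gbh_moment :: "nat \<Rightarrow> nat \<Rightarrow> real" where
  "Gbh_moment n j = (\<integral>x. x ^ n * Gbh_der j x \<partial>lborel)"

lemma Gbh_moment_eq:
  "Gbh_moment n j = cos (real (n + j) * pi / 2) * poly ((quartic_pderiv ^^ n) (monom 1 j)) 0"
  by (simp add: Gbh_moment_def power_mult_Gbh_der integral_quartic_fourier)

lemma Gbh_moment_odd: "odd (n + j) \<Longrightarrow> Gbh_moment n j = 0"
  unfolding Gbh_moment_eq mult_eq_0_iff cos_zero_iff by (metis times_divide_eq_right)

lemma Gbh_moments: "Gbh_moment 0 0 = 1" "Gbh_moment 2 0 = 0" "Gbh_moment 4 0 = - 24"
    "Gbh_moment 1 1 = - 1"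
proof -
  have "poly ((quartic_pderiv ^^ 2) (monom 1 0)) 0 = 0"
      "poly ((quartic_pderiv ^^ 4) (monom 1 0)) 0 = - 24"
    "poly (quartic_pderiv (monom 1 1)) 0 = 1"
    by (simp_all add: numeral_eq_Suc quartic_pderiv_def pderiv_pCons monom_0 monom_Suc)
  then show "Gbh_moment 0 0 = 1" "Gbh_moment 2 0 = 0" "Gbh_moment 4 0 = - 24" "Gbh_moment 1 1 = - 1"
    by (simp_all add: Gbh_moment_eq monom_0)
qed

definition Gbh_abs_moment :: "nat \<Rightarrow> nat \<Rightarrow> real" where
  "Gbh_abs_moment n j = (\<integral>x. \<bar>x\<bar> ^ n * \<bar>Gbh_der j x\<bar> \<partial>lborel)"

lemma integrable_abs_power_mult_Gbh_der: "integrable lborel (\<lambda>x. \<bar>x\<bar> ^ n * \<bar>Gbh_der j x\<bar>)"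
  using integrable_abs[OF integrable_power_mult_Gbh_der[of n j]] by (simp add: abs_mult power_abs)

lemma Gbh_abs_moment_nonneg: "Gbh_abs_moment n j \<ge> 0"
  unfolding Gbh_abs_moment_def by (intro Bochner_Integration.integral_nonneg) auto

lemma Gbh_der_0_even: "Gbh_der 0 (- x) = Gbh_der 0 x"
  by (simp add: Gbh_der_def quartic_fourier_def fourier_phase_def)

lemma fourier_phase_Gbh_der_0: "fourier_phase (Gbh_der 0) \<theta> z = cos \<theta> * exp (-(z ^ 4))"
proof -
  obtain B where "\<bar>poly 1 \<xi> * exp (-(\<xi> ^ 4))\<bar> \<le> B" for \<xi> :: real
    using poly_exp_quartic_bounded by metis
  then have "(\<integral>x. quartic_fourier 1 0 x * cos (x * z) \<partial>lborel) = 2 * pi * exp (-(z ^ 4))"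
    using fourier_inversion_cos[OF integrable_poly_exp_quartic _
        DERIV_isCont[OF poly_exp_quartic_deriv], of 1 B 0 z]
      integrable_quartic_fourier[of 1 0]
    by (simp add: quartic_fourier_def)
  then have "fourier_phase (Gbh_der 0) 0 z = exp (-(z ^ 4))"
    by (simp add: fourier_phase_def Gbh_der_def monom_0 one_pCons mult.commute[of z])
  with fourier_phase_even[of "Gbh_der 0" \<theta> z, OF integrable_Gbh_der Gbh_der_0_even] show ?thesis
    by simp
qed

definition qroot :: "real \<Rightarrow> real" where
  "qroot t = t powr (1/4)"

lemma qroot_pos: "t > 0 \<Longrightarrow> qroot t > 0"
  by (simp add: qroot_def)

lemma qroot_nonneg: "qroot t \<ge> 0"
  by (simp add: qroot_def)

lemma qroot_mono: "0 \<le> s \<Longrightarrow> s \<le> t \<Longrightarrow> qroot s \<le> qroot t"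
  by (simp add: qroot_def powr_mono2)

lemma qroot_power: "t > 0 \<Longrightarrow> qroot t ^ n = t powr (real n / 4)"
  by (simp add: qroot_def powr_realpow[symmetric] powr_powr)

lemma qroot_power4: "t > 0 \<Longrightarrow> qroot t ^ 4 = t"
  by (simp add: qroot_power)

lemma qroot_mult: "s > 0 \<Longrightarrow> t > 0 \<Longrightarrow> qroot (s * t) = qroot s * qroot t"
  by (simp add: qroot_def powr_mult)

lemma borel_measurable_qroot [measurable]: "qroot \<in> borel_measurable borel"
  unfolding qroot_def[abs_def] by measurable

lemma tendsto_qroot_0: "(qroot \<longlongrightarrow> 0) (at_right 0)"
proof -
  have "((\<lambda>t::real. t powr (1/4)) \<longlongrightarrow> 0 powr (1/4)) (at_right 0)"
    by (intro tendsto_powr2 tendsto_ident_at tendsto_const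
        eventually_mono[OF eventually_at_right_less]) simp_all
  then show ?thesis by (simp add: qroot_def[abs_def])
qed

definition Gbh_t_der :: "nat \<Rightarrow> real \<Rightarrow> real \<Rightarrow> real" where
  "Gbh_t_der j t y = Gbh_der j (y / qroot t) / qroot t ^ Suc j"

lemma Gbh_t_eq_Gbh_t_der: "Gbh_t t x = Gbh_t_der 0 t x"
proof -
  have "t powr (-1/4) = inverse (qroot t)"
    unfolding qroot_def powr_minus[symmetric] by simp
  then have "Gbh_t t x = inverse (qroot t) * Gbh_der 0 (x * inverse (qroot t))"
    by (simp only: Gbh_t_def Gbh_eq_Gbh_der)
  then show ?thesis by (simp add: Gbh_t_der_def divide_inverse mult.commute)
qed

lemma borel_measurable_Gbh_t_der [measurable (raw)]:
  assumes [measurable]: "f \<in> borel_measurable M" "g \<in> borel_measurable M"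
  shows "(\<lambda>x. Gbh_t_der j (f x) (g x)) \<in> borel_measurable M"
  unfolding Gbh_t_der_def by measurable

lemma Gbh_t_der_deriv:
  assumes "t > 0" shows "(Gbh_t_der j t has_real_derivative Gbh_t_der (Suc j) t y) (at y)"
  unfolding Gbh_t_der_def[abs_def] using qroot_pos[OF assms]
  by (auto intro!: derivative_eq_intros DERIV_chain2[OF Gbh_der_deriv])

lemma integral_Gbh_t_der_mult:
  fixes f :: "real \<Rightarrow> real"
  assumes "t > 0"
  shows "(\<integral>y. Gbh_t_der j t y * f y \<partial>lborel)
      = (\<integral>z. Gbh_der j z * f (qroot t * z) \<partial>lborel) / qroot t ^ j"
proof -
  note q = qroot_pos[OF assms]
  have "(\<integral>y. Gbh_t_der j t y * f y \<partial>lborel)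
      = \<bar>qroot t\<bar> *\<^sub>R (\<integral>z. Gbh_t_der j t (0 + qroot t * z) * f (0 + qroot t * z) \<partial>lborel)"
    by (rule lborel_integral_real_affine) (use q in auto)
  also have "\<dots> = (\<integral>z. qroot t * (Gbh_t_der j t (0 + qroot t * z) * f (0 + qroot t * z)) \<partial>lborel)"
    using q by simp
  also have "\<dots> = (\<integral>z. Gbh_der j z * f (qroot t * z) / qroot t ^ j \<partial>lborel)"
    using q by (intro Bochner_Integration.integral_cong refl) (simp add: Gbh_t_der_def)
  finally show ?thesis by simp
qed

lemma abs_power_mult_Gbh_t_der_bounded:
  assumes "t > 0" shows "\<exists>C. \<forall>y. \<bar>y\<bar> ^ n * \<bar>Gbh_t_der j t y\<bar> \<le> C"
proof -
  note q = qroot_pos[OF assms]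
  obtain C where C: "\<bar>x\<bar> ^ n * \<bar>Gbh_der j x\<bar> \<le> C" for x
    using Gbh_der_decay by metis
  have "\<bar>y\<bar> ^ n * \<bar>Gbh_t_der j t y\<bar> \<le> C * qroot t ^ n / qroot t ^ Suc j" for y
  proof -
    have "\<bar>y\<bar> ^ n * \<bar>Gbh_t_der j t y\<bar>
        = \<bar>y / qroot t\<bar> ^ n * \<bar>Gbh_der j (y / qroot t)\<bar> * qroot t ^ n / qroot t ^ Suc j"
      using q by (simp add: Gbh_t_der_def abs_mult power_divide)
    also have "\<dots> \<le> C * qroot t ^ n / qroot t ^ Suc j"
      using q by (intro divide_right_mono mult_right_mono C) auto
    finally show ?thesis .
  qed
  then show ?thesis by blast
qed

lemma one_plus_abs_power:
  fixes y :: real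
  shows "(1 + \<bar>y\<bar>) ^ n = (\<Sum>k\<le>n. real (n choose k) * \<bar>y\<bar> ^ k)"
  by (subst add.commute, subst binomial_ring) simp

lemma weighted_Gbh_t_der_bounded:
  assumes "t > 0" shows "\<exists>C. \<forall>y. (1 + \<bar>y\<bar>) ^ n * \<bar>Gbh_t_der j t y\<bar> \<le> C"
proof -
  obtain C where C: "\<bar>y\<bar> ^ k * \<bar>Gbh_t_der j t y\<bar> \<le> C k" for y k
    using abs_power_mult_Gbh_t_der_bounded[OF assms, of _ j] by metis
  have "(1 + \<bar>y\<bar>) ^ n * \<bar>Gbh_t_der j t y\<bar> \<le> (\<Sum>k\<le>n. real (n choose k) * C k)" for y
    unfolding one_plus_abs_power sum_distrib_right mult.assoc
    by (intro sum_mono mult_left_mono C) simp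
  then show ?thesis by blast
qed

lemma integrable_weighted_Gbh_t_der:
  assumes "t > 0" shows "integrable lborel (\<lambda>y. Gbh_t_der j t y * (1 + \<bar>y\<bar>) ^ n)"
proof -
  obtain C where C: "(1 + \<bar>y\<bar>) ^ (n + 2) * \<bar>Gbh_t_der j t y\<bar> \<le> C" for y
    using weighted_Gbh_t_der_bounded[OF assms] by metis
  show ?thesis
  proof (rule integrable_if_quadratic_decay)
    fix y :: real
    have "(1 + y\<^sup>2) * \<bar>Gbh_t_der j t y * (1 + \<bar>y\<bar>) ^ n\<bar>
        \<le> (1 + \<bar>y\<bar>)\<^sup>2 * \<bar>Gbh_t_der j t y * (1 + \<bar>y\<bar>) ^ n\<bar>"
      by (intro mult_right_mono) (simp_all add: power2_sum)
    also have "\<dots> = (1 + \<bar>y\<bar>) ^ (n + 2) * \<bar>Gbh_t_der j t y\<bar>"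
      by (simp add: abs_mult power_add power2_eq_square)
    finally show "(1 + y\<^sup>2) * \<bar>Gbh_t_der j t y * (1 + \<bar>y\<bar>) ^ n\<bar> \<le> C" using C[of y] by linarith
  qed simp
qed

lemma integrable_Gbh_t_der: "t > 0 \<Longrightarrow> integrable lborel (Gbh_t_der j t)"
  using integrable_weighted_Gbh_t_der[of t j 0] by simp

lemma fourier_phase_Gbh_t_der_0:
  assumes "t > 0" shows "fourier_phase (Gbh_t_der 0 t) \<theta> \<xi> = cos \<theta> * exp (-(t * \<xi> ^ 4))"
proof -
  have "fourier_phase (Gbh_t_der 0 t) \<theta> \<xi> = fourier_phase (Gbh_der 0) \<theta> (qroot t * \<xi>)"
    by (simp add: fourier_phase_def integral_Gbh_t_der_mult[OF assms] mult_ac)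
  then show ?thesis by (simp add: fourier_phase_Gbh_der_0 power_mult_distrib qroot_power4[OF assms])
qed

lemma integrable_power_exp_quartic:
  assumes "t > 0" shows "integrable lborel (\<lambda>\<xi>::real. \<xi> ^ j * exp (-(t * \<xi> ^ 4)))"
proof -
  note q = qroot_pos[OF assms]
  from lborel_integrable_real_affine[OF integrable_poly_exp_quartic[of "monom 1 j"], of "qroot t" 0]
  have "integrable lborel (\<lambda>\<xi>. (1 / qroot t ^ j)
      * ((qroot t * \<xi>) ^ j * exp (-((qroot t * \<xi>) ^ 4))))"
    using q by (simp add: poly_monom)
  then show ?thesis using q by (simp add: power_mult_distrib qroot_power4[OF assms])
qed

lemma Gbh_t_der_eq_fourier_phase:
  assumes "t > 0"
  shows "Gbh_t_der j t y = fourier_phase (\<lambda>\<xi>. \<xi> ^ j * exp (-(t * \<xi> ^ 4))) (real j * pi / 2) y /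
      (2 * pi)"
proof -
  note q = qroot_pos[OF assms]
  have "fourier_phase (\<lambda>\<xi>. (qroot t * \<xi>) ^ j * exp (-((qroot t * \<xi>) ^ 4))) (real j * pi / 2) y
      = 2 * pi * Gbh_der j (y / qroot t) / qroot t"
    using fourier_phase_scaled[OF q, of "\<lambda>\<xi>. \<xi> ^ j * exp (-(\<xi> ^ 4))" "real j * pi / 2" y]
    by (simp add: Gbh_der_def quartic_fourier_def poly_monom)
  also have "(\<lambda>\<xi>. (qroot t * \<xi>) ^ j * exp (-((qroot t * \<xi>) ^ 4)))
      = (\<lambda>\<xi>. qroot t ^ j * (\<xi> ^ j * exp (-(t * \<xi> ^ 4))))"
    by (simp add: power_mult_distrib qroot_power4[OF assms] mult_ac)
  also have "fourier_phase \<dots> (real j * pi / 2) y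
      = qroot t ^ j * fourier_phase (\<lambda>\<xi>. \<xi> ^ j * exp (-(t * \<xi> ^ 4))) (real j * pi / 2) y"
    unfolding fourier_phase_def mult.assoc[of "qroot t ^ j"] by (rule integral_mult_right_zero)
  finally show ?thesis using q by (simp add: Gbh_t_der_def field_simps)
qed

lemma Gbh_t_der_semigroup:
  assumes h: "h > 0" and t: "t > 0"
  shows "(\<integral>y. Gbh_t_der 0 h y * Gbh_t_der j t (w - y) \<partial>lborel) = Gbh_t_der j (t + h) w"
proof -
  let ?symbol = "\<lambda>\<xi>. \<xi> ^ j * exp (-(t * \<xi> ^ 4))" and ?\<theta> = "real j * pi / 2"
  have "(\<integral>y. Gbh_t_der 0 h y * Gbh_t_der j t (w - y) \<partial>lborel)
      = (\<integral>y. Gbh_t_der 0 h y * (\<integral>\<xi>. ?symbol \<xi> * cos ((w - y) * \<xi> + ?\<theta>) \<partial>lborel) \<partial>lborel) / (2 * pi)"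
    by (simp add: Gbh_t_der_eq_fourier_phase[OF t] fourier_phase_def)
  also have "(\<integral>y. Gbh_t_der 0 h y * (\<integral>\<xi>. ?symbol \<xi> * cos ((w - y) * \<xi> + ?\<theta>) \<partial>lborel) \<partial>lborel)
      = (\<integral>\<xi>. ?symbol \<xi> * (\<integral>y. Gbh_t_der 0 h y * cos ((w - y) * \<xi> + ?\<theta>) \<partial>lborel) \<partial>lborel)"
    by (rule Fubini_bounded_kernel[OF integrable_Gbh_t_der[OF h]
        integrable_power_exp_quartic[OF t]]) auto
  also have "\<dots> = fourier_phase (\<lambda>\<xi>. \<xi> ^ j * exp (-((t + h) * \<xi> ^ 4))) ?\<theta> w"
    unfolding fourier_phase_def
  proof (intro Bochner_Integration.integral_cong refl)
    fix \<xi> :: real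
    have "cos ((w - y) * \<xi> + ?\<theta>) = cos (\<xi> * y + - (w * \<xi> + ?\<theta>))" for y
      using cos_minus[of "(w - y) * \<xi> + ?\<theta>"] by (simp add: algebra_simps)
    then have "(\<integral>y. Gbh_t_der 0 h y * cos ((w - y) * \<xi> + ?\<theta>) \<partial>lborel)
        = cos (w * \<xi> + ?\<theta>) * exp (-(h * \<xi> ^ 4))"
      using fourier_phase_Gbh_t_der_0[OF h, of "- (w * \<xi> + ?\<theta>)" \<xi>]
      by (simp only: fourier_phase_def cos_minus)
    then show "?symbol \<xi> * (\<integral>y. Gbh_t_der 0 h y * cos ((w - y) * \<xi> + ?\<theta>) \<partial>lborel)
        = \<xi> ^ j * exp (-((t + h) * \<xi> ^ 4)) * cos (w * \<xi> + ?\<theta>)"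
      by (simp add: distrib_right exp_add[symmetric] mult_exp_exp)
  qed
  also have "\<dots> / (2 * pi) = Gbh_t_der j (t + h) w"
    using h t by (simp add: Gbh_t_der_eq_fourier_phase)
  finally show ?thesis .
qed

section \<open>The biharmonic semigroup\<close>

definition poly_growth :: "(real \<Rightarrow> real) \<Rightarrow> bool" where
  "poly_growth f \<longleftrightarrow> f \<in> borel_measurable borel \<and> (\<exists>C n. \<forall>x. \<bar>f x\<bar> \<le> C * (1 + \<bar>x\<bar>) ^ n)"

lemma one_plus_abs_add_le:
  fixes x y :: real shows "1 + \<bar>x + y\<bar> \<le> (1 + \<bar>x\<bar>) * (1 + \<bar>y\<bar>)"
proof -
  have "1 + \<bar>x + y\<bar> \<le> 1 + \<bar>x\<bar> + \<bar>y\<bar> + \<bar>x\<bar> * \<bar>y\<bar>"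
    using abs_triangle_ineq[of x y] mult_nonneg_nonneg[of "\<bar>x\<bar>" "\<bar>y\<bar>"] by linarith
  then show ?thesis by (simp add: algebra_simps)
qed

lemma poly_growthE:
  assumes "poly_growth f"
  obtains C n where "f \<in> borel_measurable borel" "C \<ge> 0"
    "\<And>x y. \<bar>f (x - y)\<bar> \<le> C * (1 + \<bar>x\<bar>) ^ n * (1 + \<bar>y\<bar>) ^ n"
proof -
  from assms obtain C n where f: "f \<in> borel_measurable borel" and C: "\<And>x. \<bar>f x\<bar> \<le> C * (1 + \<bar>x\<bar>) ^ n"
    by (auto simp: poly_growth_def)
  have "C \<ge> 0" using C[of 0] by simp
  moreover have "\<bar>f (x - y)\<bar> \<le> C * (1 + \<bar>x\<bar>) ^ n * (1 + \<bar>y\<bar>) ^ n" for x y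
  proof -
    have "(1 + \<bar>x - y\<bar>) ^ n \<le> ((1 + \<bar>x\<bar>) * (1 + \<bar>y\<bar>)) ^ n"
      using one_plus_abs_add_le[of x "- y"] by (intro power_mono) auto
    then show ?thesis
      using order_trans[OF C[of "x - y"] mult_left_mono[OF _ \<open>C \<ge> 0\<close>]]
      by (simp add: power_mult_distrib mult.assoc)
  qed
  ultimately show thesis by (rule that[OF f])
qed

lemma poly_growth_bounded:
  assumes "f \<in> borel_measurable borel" "\<And>x. \<bar>f x\<bar> \<le> C"
  shows "poly_growth f"
proof -
  have "\<forall>x. \<bar>f x\<bar> \<le> C * (1 + \<bar>x\<bar>) ^ 0" using assms(2) by simp
  then show ?thesis unfolding poly_growth_def using assms(1) by blast
qed

lemma poly_growth_Lipschitz: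
  assumes "L-lipschitz_on UNIV f" shows "poly_growth f"
proof -
  have "f \<in> borel_measurable borel"
    by (intro borel_measurable_continuous_onI lipschitz_on_continuous_on[OF assms])
  moreover have "\<bar>f x\<bar> \<le> (\<bar>f 0\<bar> + L) * (1 + \<bar>x\<bar>) ^ 1" for x
  proof -
    have "\<bar>f x - f 0\<bar> \<le> L * \<bar>x\<bar>"
      using lipschitz_onD[OF assms, of x 0] by (simp add: dist_real_def)
    moreover have "0 \<le> L + \<bar>f 0\<bar> * \<bar>x\<bar>" using lipschitz_on_nonneg[OF assms] by simp
    ultimately show ?thesis by (simp add: algebra_simps)
  qed
  ultimately show ?thesis unfolding poly_growth_def by blast
qed

definition biheat_der :: "nat \<Rightarrow> real \<Rightarrow> (real \<Rightarrow> real) \<Rightarrow> real \<Rightarrow> real" where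
  "biheat_der j t f x = (\<integral>y. Gbh_t_der j t y * f (x - y) \<partial>lborel)"

lemma integrable_biheat_der:
  assumes t: "t > 0" and f: "poly_growth f"
  shows "integrable lborel (\<lambda>y. Gbh_t_der j t y * f (x - y))"
proof -
  obtain C n where [measurable]: "f \<in> borel_measurable borel"
    and growth: "\<And>x y. \<bar>f (x - y)\<bar> \<le> C * (1 + \<bar>x\<bar>) ^ n * (1 + \<bar>y\<bar>) ^ n"
    using poly_growthE[OF f] by metis
  show ?thesis
  proof (rule Bochner_Integration.integrable_bound)
    show "integrable lborel (\<lambda>y. C * (1 + \<bar>x\<bar>) ^ n * (Gbh_t_der j t y * (1 + \<bar>y\<bar>) ^ n))"
      by (intro integrable_mult_right integrable_weighted_Gbh_t_der t)
    have "\<bar>Gbh_t_der j t y * f (x - y)\<bar>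
        \<le> \<bar>C * (1 + \<bar>x\<bar>) ^ n * (Gbh_t_der j t y * (1 + \<bar>y\<bar>) ^ n)\<bar>" for y
      using mult_left_mono[OF order_trans[OF growth abs_ge_self], of "\<bar>Gbh_t_der j t y\<bar>" x y]
      by (simp add: abs_mult mult_ac)
    then show "AE y in lborel. norm (Gbh_t_der j t y * f (x - y))
        \<le> norm (C * (1 + \<bar>x\<bar>) ^ n * (Gbh_t_der j t y * (1 + \<bar>y\<bar>) ^ n))"
      by simp
  qed measurable
qed

lemma poly_growth_biheat_der:
  assumes t: "t > 0" and f: "poly_growth f"
  shows "poly_growth (biheat_der j t f)"
proof -
  obtain C n where [measurable]: "f \<in> borel_measurable borel"
    and growth: "\<And>x y. \<bar>f (x - y)\<bar> \<le> C * (1 + \<bar>x\<bar>) ^ n * (1 + \<bar>y\<bar>) ^ n"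
    using poly_growthE[OF f] by metis
  let ?mass = "\<integral>y. \<bar>Gbh_t_der j t y * (1 + \<bar>y\<bar>) ^ n\<bar> \<partial>lborel"
  have "\<bar>biheat_der j t f x\<bar> \<le> (C * ?mass) * (1 + \<bar>x\<bar>) ^ n" for x
  proof -
    have "norm (biheat_der j t f x)
        \<le> (\<integral>y. C * (1 + \<bar>x\<bar>) ^ n * \<bar>Gbh_t_der j t y * (1 + \<bar>y\<bar>) ^ n\<bar> \<partial>lborel)"
      unfolding biheat_der_def
    proof (rule Bochner_Integration.integral_norm_bound_integral[OF integrable_biheat_der[OF t f]])
      show "integrable lborel (\<lambda>y. C * (1 + \<bar>x\<bar>) ^ n * \<bar>Gbh_t_der j t y * (1 + \<bar>y\<bar>) ^ n\<bar>)"
        by (intro integrable_mult_right integrable_abs integrable_weighted_Gbh_t_der t)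
      show "norm (Gbh_t_der j t y * f (x - y))
          \<le> C * (1 + \<bar>x\<bar>) ^ n * \<bar>Gbh_t_der j t y * (1 + \<bar>y\<bar>) ^ n\<bar>" for y
        using mult_left_mono[OF growth[of x y], of "\<bar>Gbh_t_der j t y\<bar>"]
        by (simp add: abs_mult mult_ac)
    qed
    then show ?thesis by (simp add: mult_ac)
  qed
  moreover have "biheat_der j t f \<in> borel_measurable borel"
    unfolding biheat_der_def[abs_def] by measurable
  ultimately show ?thesis unfolding poly_growth_def by blast
qed

lemma biheat_der_add:
  assumes "t > 0" "poly_growth f" "poly_growth g"
  shows "biheat_der j t (\<lambda>y. f y + g y) x = biheat_der j t f x + biheat_der j t g x"
  using integrable_biheat_der[OF assms(1,2), of j x] integrable_biheat_der[OF assms(1,3), of j x]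
  by (simp add: biheat_der_def distrib_left)

lemma biheat_der_reflect: "biheat_der j t f x = (\<integral>y. Gbh_t_der j t (x - y) * f y \<partial>lborel)"
  using lborel_integral_real_affine[of "-1" "\<lambda>y. Gbh_t_der j t y * f (x - y)" x]
  by (simp add: biheat_der_def)

lemma integrable_biheat_der_reflect:
  assumes "t > 0" "poly_growth f"
  shows "integrable lborel (\<lambda>y. Gbh_t_der j t (x - y) * f y)"
  using lborel_integrable_real_affine[OF integrable_biheat_der[OF assms, of j x], of "-1" x] by simp

lemma biheat_eq_biheat_der:
  assumes "t > 0" "poly_growth f"
  shows "biheat t f = biheat_der 0 t f"
  using integral_lborel[OF integrable_biheat_der_reflect[OF assms, of 0]]
  by (simp add: fun_eq_iff biheat_def biheat_der_reflect Gbh_t_eq_Gbh_t_der)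

lemma biheat_der_rescaled:
  "t > 0 \<Longrightarrow> biheat_der j t f x = (\<integral>z. Gbh_der j z * f (x - qroot t * z) \<partial>lborel) / qroot t ^ j"
  using integral_Gbh_t_der_mult[of t j "\<lambda>y. f (x - y)"] by (simp add: biheat_der_def)

lemma biheat_der_scaling:
  assumes "\<sigma> > 0" "t > 0"
  shows "biheat_der j (\<sigma> * t) f (qroot \<sigma> * x)
      = biheat_der j t (\<lambda>y. f (qroot \<sigma> * y)) x / qroot \<sigma> ^ j"
  using assms by (simp add: biheat_der_rescaled qroot_mult power_mult_distrib right_diff_distrib
      mult.assoc)

lemma biheat_der_taylor:
  assumes t: "t > 0" and [measurable]: "f \<in> borel_measurable borel"
    and remainder: "\<And>y. \<bar>f (x - y) - (\<Sum>m<n. a m * (- y) ^ m)\<bar> \<le> K * \<bar>y\<bar> ^ n"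
  shows "\<bar>biheat_der j t f x - (\<Sum>m<n. a m * (- qroot t) ^ m * Gbh_moment m j) / qroot t ^ j\<bar>
     \<le> K * Gbh_abs_moment n j * qroot t ^ n / qroot t ^ j"
proof -
  let ?q = "qroot t"
  note q = qroot_pos[OF t]
  define r where "r z = f (x - ?q * z) - (\<Sum>m<n. a m * (- (?q * z)) ^ m)" for z
  have bound: "norm (Gbh_der j z * r z) \<le> (K * ?q ^ n) * (\<bar>z\<bar> ^ n * \<bar>Gbh_der j z\<bar>)" for z
    using mult_left_mono[OF remainder[of "?q * z"], of "\<bar>Gbh_der j z\<bar>"] q
    by (simp add: r_def abs_mult power_mult_distrib mult_ac)
  have int_bound: "integrable lborel (\<lambda>z. (K * ?q ^ n) * (\<bar>z\<bar> ^ n * \<bar>Gbh_der j z\<bar>))"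
    by (intro integrable_mult_right integrable_abs_power_mult_Gbh_der)
  have int_r: "integrable lborel (\<lambda>z. Gbh_der j z * r z)"
    by (rule Bochner_Integration.integrable_bound[OF int_bound])
       (auto simp: r_def[abs_def] intro!: order_trans[OF bound[unfolded r_def real_norm_def]
           abs_ge_self])
  have "(- (?q * z)) ^ m = (- ?q) ^ m * z ^ m" for z m
    by (simp flip: power_mult_distrib)
  then have "Gbh_der j z * f (x - ?q * z)
      = Gbh_der j z * r z + (\<Sum>m<n. a m * (- ?q) ^ m * (z ^ m * Gbh_der j z))" for z
    by (simp add: r_def right_diff_distrib sum_distrib_left mult_ac)
  then have "biheat_der j t f x
      = ((\<integral>z. Gbh_der j z * r z \<partial>lborel) + (\<Sum>m<n. a m * (- ?q) ^ m * Gbh_moment m j)) / ?q ^ j"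
    using int_r by (simp add: biheat_der_rescaled[OF t] integrable_power_mult_Gbh_der
        Gbh_moment_def)
  then have "biheat_der j t f x - (\<Sum>m<n. a m * (- ?q) ^ m * Gbh_moment m j) / ?q ^ j
      = (\<integral>z. Gbh_der j z * r z \<partial>lborel) / ?q ^ j"
    by (simp add: add_divide_distrib)
  moreover have "\<bar>\<integral>z. Gbh_der j z * r z \<partial>lborel\<bar> \<le> K * Gbh_abs_moment n j * ?q ^ n"
    using Bochner_Integration.integral_norm_bound_integral[OF int_r int_bound bound]
    unfolding integral_mult_right_zero Gbh_abs_moment_def[symmetric] by (simp add: mult_ac)
  ultimately show ?thesis using q by (simp add: divide_right_mono)
qed

lemma biheat_der_bounded:
  assumes "t > 0" "f \<in> borel_measurable borel" "\<And>y. \<bar>f y\<bar> \<le> C"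
  shows "\<bar>biheat_der j t f x\<bar> \<le> C * Gbh_abs_moment 0 j / qroot t ^ j"
  using biheat_der_taylor[OF assms(1,2), where n=0 and K=C] assms(3) by simp

lemma biheat_der_0_minus_Lipschitz:
  assumes t: "t > 0" and f: "L-lipschitz_on UNIV f"
  shows "\<bar>biheat_der 0 t f x - f x\<bar> \<le> L * Gbh_abs_moment 1 0 * qroot t"
proof -
  have "\<bar>f (x - y) - (\<Sum>m<1. f x * (- y) ^ m)\<bar> \<le> L * \<bar>y\<bar> ^ 1" for y
    using lipschitz_onD[OF f, of "x - y" x] by (simp add: dist_real_def)
  moreover have "f \<in> borel_measurable borel"
    using poly_growth_Lipschitz[OF f] by (simp add: poly_growth_def)
  ultimately show ?thesis
    using biheat_der_taylor[OF t, where n=1 and a="\<lambda>_. f x" and K=L and j=0]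
    by (simp add: Gbh_moments)
qed

lemma biheat_der_0_taylor:
  assumes t: "t > 0" and f: "f \<in> borel_measurable borel"
    and remainder: "\<And>y. \<bar>f (x - y) - (\<Sum>m<5. a m * (- y) ^ m)\<bar> \<le> K * \<bar>y\<bar> ^ 5"
  shows "\<bar>biheat_der 0 t f x - (a 0 - 24 * t * a 4)\<bar> \<le> K * Gbh_abs_moment 5 0 * qroot t * t"
proof -
  have "(\<Sum>m<5. a m * (- qroot t) ^ m * Gbh_moment m 0) = a 0 - 24 * t * a 4"
    using Gbh_moment_odd[of 1 0] Gbh_moment_odd[of 3 0] qroot_power4[OF t]
    by (simp add: lessThan_nat_numeral Gbh_moments)
  moreover have "qroot t ^ 5 = qroot t * t" using qroot_power4[OF t] power_Suc[of "qroot t" 4]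
    by simp
  ultimately show ?thesis using biheat_der_taylor[OF t f remainder, of 0] by (simp add: mult.assoc)
qed

lemma biheat_der_1_taylor:
  assumes t: "t > 0" and f: "f \<in> borel_measurable borel"
    and remainder: "\<And>y. \<bar>f (x - y) - (\<Sum>m<2. a m * (- y) ^ m)\<bar> \<le> K * \<bar>y\<bar> ^ 2"
  shows "\<bar>biheat_der 1 t f x - a 1\<bar> \<le> K * Gbh_abs_moment 2 1 * qroot t"
proof -
  note q = qroot_pos[OF t]
  have "(\<Sum>m<2. a m * (- qroot t) ^ m * Gbh_moment m 1) / qroot t ^ 1 = a 1"
    using q Gbh_moment_odd[of 0 1] Gbh_moments(4) by (simp add: lessThan_nat_numeral)
  moreover have "K * Gbh_abs_moment 2 1 * qroot t ^ 2 / qroot t ^ 1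
      = K * Gbh_abs_moment 2 1 * qroot t"
    using q by (simp add: power2_eq_square)
  ultimately show ?thesis using biheat_der_taylor[OF t f remainder, of 1] by simp
qed

lemma biheat_generator:
  assumes f: "f \<in> borel_measurable borel"
    and remainder: "\<And>y. \<bar>f (x - y) - (\<Sum>m<5. a m * (- y) ^ m)\<bar> \<le> K * \<bar>y\<bar> ^ 5"
  shows "((\<lambda>h. (biheat_der 0 h f x - a 0) / h) \<longlongrightarrow> - 24 * a 4) (at_right 0)"
proof -
  have "((\<lambda>h. (biheat_der 0 h f x - a 0) / h - (- 24 * a 4)) \<longlongrightarrow> 0) (at_right 0)"
  proof (rule Lim_null_comparison)
    show "\<forall>\<^sub>F h in at_right 0. norm ((biheat_der 0 h f x - a 0) / h - (- 24 * a 4))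
        \<le> K * Gbh_abs_moment 5 0 * qroot h"
      using eventually_at_right_less[of 0]
    proof eventually_elim
      case (elim h)
      have "(biheat_der 0 h f x - a 0) / h - (- 24 * a 4)
          = (biheat_der 0 h f x - (a 0 - 24 * h * a 4)) / h"
        using elim by (simp add: field_simps)
      moreover have "\<bar>biheat_der 0 h f x - (a 0 - 24 * h * a 4)\<bar> / h
          \<le> K * Gbh_abs_moment 5 0 * qroot h"
        using biheat_der_0_taylor[OF elim f remainder] elim by (simp add: pos_divide_le_eq)
      ultimately show ?case using elim by simp
    qed
    show "((\<lambda>h. K * Gbh_abs_moment 5 0 * qroot h) \<longlongrightarrow> 0) (at_right 0)"
      by (rule tendsto_mult_right_zero[OF tendsto_qroot_0])
  qed
  then show ?thesis by (simp only: LIM_zero_iff)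
qed

lemma Gbh_t_der_translate_dominated:
  assumes t: "t > 0" and f: "poly_growth f"
  obtains K where "\<And>u y. \<bar>u - x\<bar> < 1 \<Longrightarrow> \<bar>Gbh_t_der j t (u - y) * f y\<bar> \<le> K * (1 / (1 + (x - y)\<^sup>2))"
proof -
  obtain C n where C: "C \<ge> 0" and growth: "\<And>x y. \<bar>f (x - y)\<bar> \<le> C * (1 + \<bar>x\<bar>) ^ n * (1 + \<bar>y\<bar>) ^ n"
    using poly_growthE[OF f] by metis
  obtain D where D: "(1 + \<bar>w\<bar>) ^ (n + 2) * \<bar>Gbh_t_der j t w\<bar> \<le> D" for w
    using weighted_Gbh_t_der_bounded[OF t] by metis
  define B where "B = 4 * (C * (2 + \<bar>x\<bar>) ^ n)"
  have B: "B \<ge> 0" using C by (simp add: B_def)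
  have "\<bar>Gbh_t_der j t (u - y) * f y\<bar> \<le> (B * D) * (1 / (1 + (x - y)\<^sup>2))" if u: "\<bar>u - x\<bar> < 1" for u y
  proof -
    have "1 + \<bar>x - y\<bar> \<le> (1 + \<bar>x - u\<bar>) * (1 + \<bar>u - y\<bar>)"
      using one_plus_abs_add_le[of "x - u" "u - y"] by simp
    also have "\<dots> \<le> 2 * (1 + \<bar>u - y\<bar>)"
      using u by (intro mult_right_mono) auto
    finally have "(1 + \<bar>x - y\<bar>)\<^sup>2 \<le> (2 * (1 + \<bar>u - y\<bar>))\<^sup>2" by (rule power_mono) simp
    moreover have "(2 * (1 + \<bar>u - y\<bar>))\<^sup>2 = 4 * (1 + \<bar>u - y\<bar>)\<^sup>2"
      by (subst power_mult_distrib) simp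
    moreover have "1 + (x - y)\<^sup>2 \<le> (1 + \<bar>x - y\<bar>)\<^sup>2" by (simp add: power2_sum)
    ultimately have weight: "1 + (x - y)\<^sup>2 \<le> 4 * (1 + \<bar>u - y\<bar>)\<^sup>2" by linarith
    have "\<bar>f y\<bar> \<le> C * (1 + \<bar>u\<bar>) ^ n * (1 + \<bar>u - y\<bar>) ^ n"
      using growth[of u "u - y"] by simp
    also have "\<dots> \<le> C * (2 + \<bar>x\<bar>) ^ n * (1 + \<bar>u - y\<bar>) ^ n"
      using u C by (intro mult_right_mono mult_left_mono power_mono) auto
    finally have f_bound: "\<bar>f y\<bar> \<le> C * (2 + \<bar>x\<bar>) ^ n * (1 + \<bar>u - y\<bar>) ^ n" .
    have "(1 + (x - y)\<^sup>2) * \<bar>Gbh_t_der j t (u - y) * f y\<bar>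
        \<le> (4 * (1 + \<bar>u - y\<bar>)\<^sup>2) * (\<bar>Gbh_t_der j t (u - y)\<bar> *
            (C * (2 + \<bar>x\<bar>) ^ n * (1 + \<bar>u - y\<bar>) ^ n))"
      unfolding abs_mult
      by (rule mult_mono[OF weight mult_left_mono[OF f_bound abs_ge_zero]]) simp_all
    also have "\<dots> = B * ((1 + \<bar>u - y\<bar>) ^ (n + 2) * \<bar>Gbh_t_der j t (u - y)\<bar>)"
      unfolding B_def power_add by (simp only: mult_ac)
    also have "\<dots> \<le> B * D" by (intro mult_left_mono D B)
    finally show ?thesis by (simp add: pos_le_divide_eq add_pos_nonneg mult.commute)
  qed
  then show thesis by (rule that)
qed

lemma biheat_der_deriv:
  assumes t: "t > 0" and f: "poly_growth f"
  shows "(biheat_der j t f has_real_derivative biheat_der (Suc j) t f x) (at x)"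
proof -
  obtain K where K: "\<And>u y. \<bar>u - x\<bar> < 1 \<Longrightarrow> \<bar>Gbh_t_der (Suc j) t (u - y) * f y\<bar>
      \<le> K * (1 / (1 + (x - y)\<^sup>2))"
    using Gbh_t_der_translate_dominated[OF t f] by metis
  show ?thesis
    unfolding biheat_der_reflect[abs_def]
  proof (rule has_real_derivative_integral[where d=1,
        OF _ integrable_biheat_der_reflect[OF t f] _ K])
    show "integrable lborel (\<lambda>y. K * (1 / (1 + (x - y)\<^sup>2)))"
      by (rule integrable_mult_right)
         (use lborel_integrable_real_affine[OF integrable_inverse_one_plus_square, of "-1" x]
           in simp)
    show "(\<lambda>y. Gbh_t_der (Suc j) t (x - y) * f y) \<in> borel_measurable lborel"
      using integrable_biheat_der_reflect[OF t f] by (rule borel_measurable_integrable)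
    show "((\<lambda>x. Gbh_t_der j t (x - y) * f y)
        has_real_derivative Gbh_t_der (Suc j) t (u - y) * f y) (at u)" for u y
      by (auto intro!: derivative_eq_intros DERIV_chain2[OF Gbh_t_der_deriv[OF t]])
  qed auto
qed

lemma deriv_biheat:
  assumes "t > 0" "poly_growth f"
  shows "(deriv ^^ j) (biheat t f) = biheat_der j t f"
  using biheat_eq_biheat_der[OF assms] DERIV_imp_deriv[OF biheat_der_deriv[OF assms]]
  by (induction j) auto

lemma biheat_der_deriv_Lipschitz:
  assumes t: "t > 0" and f: "L-lipschitz_on UNIV f" and S: "countable S"
    and deriv: "\<And>y. y \<notin> S \<Longrightarrow> (f has_real_derivative f' y) (at y)"
    and [measurable]: "f' \<in> borel_measurable borel"
  shows "(biheat_der j t f has_real_derivative biheat_der j t f' x) (at x)"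
  unfolding biheat_der_def
proof (rule has_real_derivative_integral_Lipschitz[where d=1 and g="\<lambda>y. L * \<bar>Gbh_t_der j t y\<bar>"])
  show "integrable lborel (\<lambda>y. Gbh_t_der j t y * f (x - y))" for x
    by (rule integrable_biheat_der[OF t poly_growth_Lipschitz[OF f]])
  have "AE y in lborel. y \<notin> (-) x ` S"
    by (intro AE_not_in countable_imp_null_set_lborel countable_image S)
  then show "AE y in lborel. ((\<lambda>x. Gbh_t_der j t y * f (x - y))
      has_real_derivative Gbh_t_der j t y * f' (x - y)) (at x)"
  proof eventually_elim
    case (elim y)
    then have "x - y \<notin> S" by (metis diff_diff_eq2 add_diff_cancel_left' image_eqI)
    then have "((\<lambda>x. f (x - y)) has_real_derivative f' (x - y) * 1) (at x)"
      by (intro DERIV_chain2[OF deriv]) (auto intro!: derivative_eq_intros)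
    from DERIV_cmult[OF this, of "Gbh_t_der j t y"] show ?case by simp
  qed
  show "integrable lborel (\<lambda>y. L * \<bar>Gbh_t_der j t y\<bar>)"
    by (intro integrable_mult_right integrable_abs integrable_Gbh_t_der t)
  show "\<bar>Gbh_t_der j t y * f (u - y) - Gbh_t_der j t y * f (x - y)\<bar>
      \<le> L * \<bar>Gbh_t_der j t y\<bar> * \<bar>u - x\<bar>" for u y
    using mult_left_mono[OF lipschitz_onD[OF f, of "u - y" "x - y"], of "\<bar>Gbh_t_der j t y\<bar>"]
    by (simp add: dist_real_def abs_mult mult_ac flip: right_diff_distrib)
qed auto

lemma biheat_der_semigroup:
  assumes h: "h > 0" and t: "t > 0" and f: "poly_growth f"
  shows "biheat_der 0 h (biheat_der j t f) x = biheat_der j (t + h) f x"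
proof -
  obtain C n where [measurable]: "f \<in> borel_measurable borel"
    and C: "C \<ge> 0" and growth: "\<And>x y. \<bar>f (x - y)\<bar> \<le> C * (1 + \<bar>x\<bar>) ^ n * (1 + \<bar>y\<bar>) ^ n"
    using poly_growthE[OF f] by metis
  let ?K = "C * (1 + \<bar>x\<bar>) ^ n"
  let ?a = "\<lambda>y. ?K * (Gbh_t_der 0 h y * (1 + \<bar>y\<bar>) ^ n)"
  let ?b = "\<lambda>y w. Gbh_t_der j t (- y + 1 * w) * (1 + \<bar>- y + 1 * w\<bar>) ^ n"
  have shift: "biheat_der j t f (x - y) = (\<integral>w. Gbh_t_der j t (w - y) * f (x - w) \<partial>lborel)" for y
    using lborel_integral_real_affine[of 1 "\<lambda>z. Gbh_t_der j t z * f (x - y - z)" "-y"]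
    by (simp add: biheat_der_def)
  have "biheat_der 0 h (biheat_der j t f) x
      = (\<integral>y. \<integral>w. Gbh_t_der 0 h y * (Gbh_t_der j t (w - y) * f (x - w)) \<partial>lborel \<partial>lborel)"
    by (simp only: biheat_der_def[of 0 h] shift integral_mult_right_zero)
  also have "\<dots> = (\<integral>w. \<integral>y. Gbh_t_der 0 h y * (Gbh_t_der j t (w - y) * f (x - w)) \<partial>lborel \<partial>lborel)"
  proof (rule Fubini_dominated[where a="?a" and b="?b"])
    show "integrable lborel ?a"
      by (intro integrable_mult_right integrable_weighted_Gbh_t_der h)
    show "integrable lborel (?b y)" for y
      by (rule lborel_integrable_real_affine[OF integrable_weighted_Gbh_t_der[OF t]]) simp
    show "(\<integral>w. \<bar>?b y w\<bar> \<partial>lborel) \<le> (\<integral>z. \<bar>Gbh_t_der j t z * (1 + \<bar>z\<bar>) ^ n\<bar> \<partial>lborel)" for y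
      using lborel_integral_real_affine[of 1 "\<lambda>z. \<bar>Gbh_t_der j t z * (1 + \<bar>z\<bar>) ^ n\<bar>" "-y"] by simp
    fix y w :: real
    have "(1 + \<bar>w\<bar>) ^ n \<le> (1 + \<bar>y\<bar>) ^ n * (1 + \<bar>w - y\<bar>) ^ n"
      using one_plus_abs_add_le[of y "w - y"]
      by (simp flip: power_mult_distrib) (rule power_mono, auto)
    then have "\<bar>f (x - w)\<bar> \<le> ?K * ((1 + \<bar>y\<bar>) ^ n * (1 + \<bar>w - y\<bar>) ^ n)"
      using C by (intro order_trans[OF growth mult_left_mono]) auto
    from mult_left_mono[OF this, of "\<bar>Gbh_t_der 0 h y * Gbh_t_der j t (w - y)\<bar>"]
    show "\<bar>Gbh_t_der 0 h y * (Gbh_t_der j t (w - y) * f (x - w))\<bar> \<le> \<bar>?a y\<bar> * \<bar>?b y w\<bar>"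
      using C by (simp add: abs_mult mult_ac)
  qed measurable
  also have "\<dots> = (\<integral>w. (\<integral>y. Gbh_t_der 0 h y * Gbh_t_der j t (w - y) \<partial>lborel) * f (x - w) \<partial>lborel)"
    by (simp only: mult.assoc[symmetric] integral_mult_left_zero)
  also have "\<dots> = biheat_der j (t + h) f x"
    by (simp only: Gbh_t_der_semigroup[OF h t] biheat_der_def)
  finally show ?thesis .
qed

section \<open>Duhamel integrals\<close>

definition duhamel_weight :: "nat \<Rightarrow> real \<Rightarrow> real \<Rightarrow> real \<Rightarrow> real" where
  "duhamel_weight j a b s = (b - s) powr (-(real j / 4)) * (s - a) powr (-1/2)"

lemma
  assumes j: "j < 4"
  shows set_integrable_duhamel_weight_unit: "set_integrable lborel {0<..<1} (duhamel_weight j 0 1)"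
    and set_integral_duhamel_weight_unit:
      "(LINT r:{0<..<1}|lborel. duhamel_weight j 0 1 r) = Beta (1/2) (1 - real j / 4)"
proof -
  have weight: "duhamel_weight j 0 1 = (\<lambda>r. r powr (1/2 - 1) * (1 - r) powr ((1 - real j / 4) - 1))"
    by (simp add: duhamel_weight_def fun_eq_iff mult.commute)
  have "set_integrable lborel {0..1} (duhamel_weight j 0 1)"
    unfolding weight by (rule integrable_Beta) (use j in auto)
  then show int: "set_integrable lborel {0<..<1} (duhamel_weight j 0 1)"
    by (rule set_integrable_subset) auto
  have "(duhamel_weight j 0 1 has_integral Beta (1/2) (1 - real j / 4)) {0<..<1}"
    unfolding weight has_integral_Icc_iff_Ioo[symmetric]
    by (rule has_integral_Beta_real) (use j in auto)
  with set_borel_integral_eq_integral(2)[OF int]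
  show "(LINT r:{0<..<1}|lborel. duhamel_weight j 0 1 r) = Beta (1/2) (1 - real j / 4)"
    by (simp add: integral_unique)
qed

lemma indicator_Ioo_affine:
  fixes a b r :: real
  assumes "a < b"
  shows "indicator {a<..<b} (a + (b - a) * r) = (indicator {0<..<1} r :: real)"
proof -
  have "a + (b - a) * r < b \<longleftrightarrow> (b - a) * r < (b - a) * 1" by auto
  then have "a + (b - a) * r \<in> {a<..<b} \<longleftrightarrow> r \<in> {0<..<1}"
    using assms by (simp add: zero_less_mult_iff del: mult_1_right)
  then show ?thesis by (simp add: indicator_def)
qed

lemma duhamel_weight_affine:
  assumes "a < b" "0 < r" "r < 1"
  shows "duhamel_weight j a b (a + (b - a) * r)
      = (b - a) powr (-(real j / 4) - 1/2) * duhamel_weight j 0 1 r"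
proof -
  have "duhamel_weight j a b (a + (b - a) * r)
      = ((b - a) * (1 - r)) powr (-(real j / 4)) * ((b - a) * r) powr (-1/2)"
    by (simp add: duhamel_weight_def algebra_simps)
  also have "\<dots> = ((b - a) powr (-(real j / 4)) * (b - a) powr (-1/2)) * duhamel_weight j 0 1 r"
    using assms by (simp add: powr_mult duhamel_weight_def)
  also have "(b - a) powr (-(real j / 4)) * (b - a) powr (-1/2)
      = (b - a) powr (-(real j / 4) - 1/2)"
    by (subst powr_add[symmetric]) simp
  finally show ?thesis .
qed

lemma
  assumes ab: "a < b" and j: "j < 4"
  shows set_integrable_duhamel_weight: "set_integrable lborel {a<..<b} (duhamel_weight j a b)"
    and set_integral_duhamel_weight:
      "(LINT s:{a<..<b}|lborel. duhamel_weight j a b s)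
          = Beta (1/2) (1 - real j / 4) * (b - a) powr (1/2 - real j / 4)"
proof -
  let ?f = "\<lambda>s. indicator {a<..<b} s *\<^sub>R duhamel_weight j a b s"
  let ?c = "(b - a) powr (-(real j / 4) - 1/2)"
  have rescaled: "?f (a + (b - a) * r)
      = ?c * (indicator {0<..<1} r *\<^sub>R duhamel_weight j 0 1 r)" for r
    using duhamel_weight_affine[OF ab, of r j]
    by (simp add: indicator_Ioo_affine[OF ab]) (simp add: indicator_def)
  have "integrable lborel (\<lambda>r. ?f (a + (b - a) * r))"
    using set_integrable_duhamel_weight_unit[OF j] unfolding rescaled set_integrable_def by simp
  then show "set_integrable lborel {a<..<b} (duhamel_weight j a b)"
    using ab lborel_integrable_real_affine_iff[of "b - a" ?f a] by (simp add: set_integrable_def)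
  have "(\<integral>s. ?f s \<partial>lborel) = \<bar>b - a\<bar> *\<^sub>R (\<integral>r. ?f (a + (b - a) * r) \<partial>lborel)"
    by (rule lborel_integral_real_affine) (use ab in auto)
  also have "\<dots> = ((b - a) powr 1 * ?c) * Beta (1/2) (1 - real j / 4)"
    unfolding rescaled using ab set_integral_duhamel_weight_unit[OF j]
    by (simp add: set_lebesgue_integral_def)
  also have "(b - a) powr 1 * ?c = (b - a) powr (1/2 - real j / 4)"
    by (subst powr_add[symmetric]) simp
  finally show "(LINT s:{a<..<b}|lborel. duhamel_weight j a b s)
      = Beta (1/2) (1 - real j / 4) * (b - a) powr (1/2 - real j / 4)"
    by (simp add: set_lebesgue_integral_def mult.commute)
qed

lemma set_integral_minus_const_le:
  fixes g :: "real \<Rightarrow> real"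
  assumes ab: "a < b" and g: "set_integrable lborel {a<..<b} g"
    and close: "\<And>s. a < s \<Longrightarrow> s < b \<Longrightarrow> \<bar>g s - c\<bar> \<le> e"
  shows "\<bar>(LINT s:{a<..<b}|lborel. g s) - (b - a) * c\<bar> \<le> (b - a) * e"
proof -
  have const: "set_integrable lborel {a<..<b} (\<lambda>s. k)"
      "(LINT s:{a<..<b}|lborel. k) = (b - a) * k" for k :: real
    using ab by (simp_all add: set_integrable_def set_lebesgue_integral_def)
  have diff: "set_integrable lborel {a<..<b} (\<lambda>s. g s - c)"
    by (intro set_integral_diff g const)
  have "\<bar>(LINT s:{a<..<b}|lborel. g s) - (b - a) * c\<bar> = norm (LINT s:{a<..<b}|lborel. g s - c)"
    by (simp add: set_integral_diff(2)[OF g const(1)] const(2))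
  also have "\<dots> \<le> (LINT s:{a<..<b}|lborel. norm (g s - c))"
    by (rule set_integral_norm_bound[OF diff])
  also have "\<dots> \<le> (LINT s:{a<..<b}|lborel. e)"
    by (rule set_integral_mono[OF set_integrable_norm[OF diff] const(1)]) (use close in auto)
  finally show ?thesis unfolding const(2) .
qed

lemma tendsto_set_integral_average:
  fixes g :: "real \<Rightarrow> real \<Rightarrow> real"
  assumes g: "\<And>h. h > 0 \<Longrightarrow> set_integrable lborel {t<..<t + h} (g h)"
    and close: "\<And>e. e > 0 \<Longrightarrow> \<forall>\<^sub>F h in at_right 0. \<forall>s\<in>{t<..<t + h}. \<bar>g h s - c\<bar> \<le> e"
  shows "((\<lambda>h. (LINT s:{t<..<t + h}|lborel. g h s) / h) \<longlongrightarrow> c) (at_right 0)"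
proof (rule tendstoI)
  fix e :: real assume e: "e > 0"
  then have "\<forall>\<^sub>F h in at_right 0. \<forall>s\<in>{t<..<t + h}. \<bar>g h s - c\<bar> \<le> e / 2"
    by (intro close) simp
  with eventually_at_right_less[of 0]
  show "\<forall>\<^sub>F h in at_right 0. dist ((LINT s:{t<..<t + h}|lborel. g h s) / h) c < e"
  proof eventually_elim
    case (elim h)
    let ?I = "LINT s:{t<..<t + h}|lborel. g h s"
    have "\<bar>?I - h * c\<bar> \<le> h * (e / 2)"
      using set_integral_minus_const_le[OF _ g, of h c "e / 2"] elim by simp
    then have "\<bar>?I - h * c\<bar> / h \<le> e / 2"
      using elim(1) by (simp add: pos_divide_le_eq mult.commute)
    moreover have "?I / h - c = (?I - h * c) / h"
      using elim(1) by (simp add: field_simps)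
    ultimately have "\<bar>?I / h - c\<bar> \<le> e / 2"
      using elim(1) by (simp only: abs_divide abs_of_pos)
    then show ?case using e by (simp add: dist_real_def)
  qed
qed

locale duhamel_source =
  fixes N :: "real \<Rightarrow> real \<Rightarrow> real" and C :: real
  assumes source_continuous: "continuous_on (UNIV \<times> {0<..}) (\<lambda>p. N (fst p) (snd p))"
    and source_bound: "\<And>y s. s > 0 \<Longrightarrow> \<bar>N y s\<bar> \<le> C * s powr (-1/2)"
begin

lemma C_nonneg: "C \<ge> 0"
  using source_bound[of 1 0] by (simp add: order_trans[OF abs_ge_zero])

definition duhamel :: "nat \<Rightarrow> real \<Rightarrow> real \<Rightarrow> real \<Rightarrow> real" where
  "duhamel j a b x = (LINT s:{a<..<b}|lborel. biheat_der j (b - s) (\<lambda>y. N y s) x)"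

lemma borel_measurable_source [measurable (raw)]:
  assumes [measurable]: "f \<in> borel_measurable M" "g \<in> borel_measurable M"
  shows "(\<lambda>x. if g x > 0 then N (f x) (g x) else 0) \<in> borel_measurable M"
proof -
  have "UNIV \<times> {0<..} \<in> sets (borel :: (real \<times> real) measure)"
    by (intro borel_open open_Times) auto
  then have "(\<lambda>p. indicator (UNIV \<times> {0<..}) p *\<^sub>R N (fst p) (snd p)) \<in> borel_measurable borel"
    by (rule borel_measurable_continuous_on_indicator[OF _ source_continuous])
  also have "(\<lambda>p. indicator (UNIV \<times> {0<..}) p *\<^sub>R N (fst p) (snd p))
      = (\<lambda>p. if snd p > 0 then N (fst p) (snd p) else 0)"
    by (auto simp: indicator_def)
  finally have meas: "(\<lambda>p. if snd p > 0 then N (fst p) (snd p) else 0) \<in> borel_measurable borel" .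
  have "(\<lambda>x. (f x, g x)) \<in> measurable M (borel :: (real \<times> real) measure)"
    unfolding borel_prod[symmetric] by measurable
  from measurable_compose[OF this meas] show ?thesis by (simp only: fst_conv snd_conv)
qed

lemma poly_growth_source: "s > 0 \<Longrightarrow> poly_growth (\<lambda>y. N y s)"
  using borel_measurable_source[of "\<lambda>y. y" borel "\<lambda>_. s"] source_bound[of s]
  by (intro poly_growth_bounded[of _ "C * s powr (-1/2)"]) simp_all

lemma borel_measurable_biheat_der_source [measurable (raw)]:
  assumes [measurable]: "f \<in> borel_measurable M" "g \<in> borel_measurable M" "r \<in> borel_measurable M"
  shows "(\<lambda>x. indicator {0<..} (g x) * biheat_der j (r x) (\<lambda>y. N y (g x)) (f x))
      \<in> borel_measurable M"
proof -
  have "(\<lambda>x. \<integral>y. Gbh_t_der j (r x) y * (if g x > 0 then N (f x - y) (g x) else 0) \<partial>lborel)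
      \<in> borel_measurable M"
    by measurable
  also have "(\<lambda>x. \<integral>y. Gbh_t_der j (r x) y * (if g x > 0 then N (f x - y) (g x) else 0) \<partial>lborel)
      = (\<lambda>x. indicator {0<..} (g x) * biheat_der j (r x) (\<lambda>y. N y (g x)) (f x))"
    by (auto simp: biheat_der_def indicator_def)
  finally show ?thesis .
qed

lemma set_borel_measurable_biheat_der_source:
  assumes "0 \<le> a"
  shows "set_borel_measurable lborel {a<..<b} (\<lambda>s. biheat_der j (c - s) (\<lambda>y. N y s) x)"
proof -
  have "(\<lambda>s. indicator {a<..<b} s * (indicator {0<..} s * biheat_der j (c - s) (\<lambda>y. N y s) x))
      \<in> borel_measurable borel"
    by measurable
  also have "(\<lambda>s. indicator {a<..<b} s * (indicator {0<..} s * biheat_der j (c - s) (\<lambda>y. N y s) x))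
     = (\<lambda>s. indicator {a<..<b} s *\<^sub>R biheat_der j (c - s) (\<lambda>y. N y s) x)"
    using assms by (auto simp: indicator_def)
  finally show ?thesis by (simp add: set_borel_measurable_def)
qed

lemma biheat_der_source_bound:
  assumes "0 \<le> a" "a < s" "s < b"
  shows "\<bar>biheat_der j (b - s) (\<lambda>y. N y s) x\<bar> \<le> C * Gbh_abs_moment 0 j * duhamel_weight j a b s"
proof -
  have "\<bar>N y s\<bar> \<le> C * (s - a) powr (-1/2)" for y
    using assms C_nonneg powr_mono2'[of "-1/2" "s - a" s]
    by (intro order_trans[OF source_bound mult_left_mono]) auto
  then have "\<bar>biheat_der j (b - s) (\<lambda>y. N y s) x\<bar>
      \<le> (C * (s - a) powr (-1/2)) * Gbh_abs_moment 0 j / qroot (b - s) ^ j"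
    using assms poly_growth_source[of s] by (intro biheat_der_bounded) (auto simp: poly_growth_def)
  also have "\<dots> = C * Gbh_abs_moment 0 j * duhamel_weight j a b s"
    using assms by (simp add: duhamel_weight_def qroot_power powr_minus field_simps)
  finally show ?thesis .
qed

lemma
  assumes a: "0 \<le> a" "a < b" and j: "j < 4"
  shows set_integrable_biheat_der_source: "set_integrable lborel {a<..<b}
      (\<lambda>s. biheat_der j (b - s) (\<lambda>y. N y s) x)"
    and duhamel_bound: "\<bar>duhamel j a b x\<bar>
        \<le> C * Gbh_abs_moment 0 j * Beta (1/2) (1 - real j / 4) * (b - a) powr (1/2 - real j / 4)"
proof -
  let ?f = "\<lambda>s. biheat_der j (b - s) (\<lambda>y. N y s) x"
  let ?w = "\<lambda>s. C * Gbh_abs_moment 0 j * duhamel_weight j a b s"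
  have w: "set_integrable lborel {a<..<b} ?w"
    by (intro set_integrable_mult_right set_integrable_duhamel_weight a j)
  have bound: "s \<in> {a<..<b} \<Longrightarrow> norm (?f s) \<le> ?w s" for s
    using biheat_der_source_bound[OF a(1)] by simp
  show f: "set_integrable lborel {a<..<b} ?f"
    by (rule set_integrable_bound[OF w set_borel_measurable_biheat_der_source[OF a(1)]])
       (use order_trans[OF bound abs_ge_self] in auto)
  have "norm (duhamel j a b x) \<le> (LINT s:{a<..<b}|lborel. norm (?f s))"
    unfolding duhamel_def by (rule set_integral_norm_bound[OF f])
  also have "\<dots> \<le> (LINT s:{a<..<b}|lborel. ?w s)"
    by (rule set_integral_mono[OF set_integrable_norm[OF f] w bound])
  finally show "\<bar>duhamel j a b x\<bar>
      \<le> C * Gbh_abs_moment 0 j * Beta (1/2) (1 - real j / 4) * (b - a) powr (1/2 - real j / 4)"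
    by (simp add: set_integral_duhamel_weight[OF a(2) j] mult.assoc)
qed

lemma integral_deriv_biheat_source:
  assumes t: "t > 0" and j: "j < 4"
  shows "integral {0..t} (\<lambda>s. (deriv ^^ j) (biheat (t - s) (\<lambda>y. N y s)) x) = duhamel j 0 t x"
proof -
  have "integral {0..t} (\<lambda>s. (deriv ^^ j) (biheat (t - s) (\<lambda>y. N y s)) x)
      = integral {0<..<t} (\<lambda>s. biheat_der j (t - s) (\<lambda>y. N y s) x)"
    unfolding integral_open_interval_real
    by (rule integral_cong) (simp add: deriv_biheat poly_growth_source)
  also have "\<dots> = duhamel j 0 t x"
    unfolding duhamel_def
    by (rule set_borel_integral_eq_integral(2)[symmetric, OF set_integrable_biheat_der_source])
       (use t j in auto)
  finally show ?thesis .
qed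

lemma duhamel_deriv:
  assumes a: "0 \<le> a" "a < b" and j: "Suc j < 4"
  shows "(duhamel j a b has_real_derivative duhamel (Suc j) a b x) (at x)"
  unfolding duhamel_def[abs_def] set_lebesgue_integral_def
proof (rule has_real_derivative_integral[where d=1
      and g="\<lambda>s. indicator {a<..<b} s *\<^sub>R
          (C * Gbh_abs_moment 0 (Suc j) * duhamel_weight (Suc j) a b s)"])
  show "integrable lborel (\<lambda>s. indicator {a<..<b} s *\<^sub>R
      (C * Gbh_abs_moment 0 (Suc j) * duhamel_weight (Suc j) a b s))"
    unfolding set_integrable_def[symmetric]
    by (intro set_integrable_mult_right set_integrable_duhamel_weight a j)
  show "integrable lborel (\<lambda>s. indicator {a<..<b} s *\<^sub>R biheat_der j (b - s) (\<lambda>y. N y s) x)" for x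
    using set_integrable_biheat_der_source[OF a, of j x] j by (simp add: set_integrable_def)
  show "(\<lambda>s. indicator {a<..<b} s *\<^sub>R biheat_der (Suc j) (b - s) (\<lambda>y. N y s) x)
      \<in> borel_measurable lborel"
    using set_borel_measurable_biheat_der_source[OF a(1)] by (simp add: set_borel_measurable_def)
  fix x s
  show "\<bar>indicator {a<..<b} s *\<^sub>R biheat_der (Suc j) (b - s) (\<lambda>y. N y s) x\<bar>
      \<le> indicator {a<..<b} s *\<^sub>R (C * Gbh_abs_moment 0 (Suc j) * duhamel_weight (Suc j) a b s)"
    using biheat_der_source_bound[OF a(1), of s b "Suc j" x] by (simp add: indicator_def)
  show "((\<lambda>x. indicator {a<..<b} s *\<^sub>R biheat_der j (b - s) (\<lambda>y. N y s) x) has_real_derivative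
      indicator {a<..<b} s *\<^sub>R biheat_der (Suc j) (b - s) (\<lambda>y. N y s) x) (at x)"
    using biheat_der_deriv[OF _ poly_growth_source, of "b - s" s j x] a by (simp add: indicator_def)
qed simp

lemma poly_growth_duhamel:
  assumes "0 \<le> a" "a < b" "Suc j < 4"
  shows "poly_growth (duhamel j a b)"
proof (rule poly_growth_bounded[OF borel_measurable_continuous_onI])
  show "continuous_on UNIV (duhamel j a b)"
    by (intro continuous_at_imp_continuous_on ballI DERIV_isCont[OF duhamel_deriv[OF assms]])
qed (rule duhamel_bound, use assms in auto)

lemma duhamel_split:
  assumes a: "0 \<le> a" "a < m" "m < b" and j: "j < 4"
  shows "duhamel j a b x = (LINT s:{a<..<m}|lborel. biheat_der j (b - s) (\<lambda>y. N y s) x)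
      + duhamel j m b x"
proof -
  let ?f = "\<lambda>s. biheat_der j (b - s) (\<lambda>y. N y s) x"
  have int: "set_integrable lborel {a<..<b} ?f"
    by (rule set_integrable_biheat_der_source) (use a j in auto)
  have "{a<..<b} = {a<..<m} \<union> {m..<b}" using a by auto
  then have "duhamel j a b x = (LINT s:{a<..<m}|lborel. ?f s) + (LINT s:{m..<b}|lborel. ?f s)"
    unfolding duhamel_def
    by (simp only:) (rule set_integral_Un; use a in \<open>auto intro: set_integrable_subset[OF int]\<close>)
  also have "(LINT s:{m..<b}|lborel. ?f s) = duhamel j m b x"
    unfolding duhamel_def by (rule set_integral_discrete_difference[of "{m}"]) auto
  finally show ?thesis .
qed

lemma biheat_der_0_duhamel:
  assumes a: "0 \<le> a" "a < b" and h: "h > 0" and j: "j < 4"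
  shows "biheat_der 0 h (duhamel j a b) x
      = (LINT s:{a<..<b}|lborel. biheat_der j (b + h - s) (\<lambda>z. N z s) x)"
proof -
  let ?w = "\<lambda>s. indicator {a<..<b} s *\<^sub>R (C * Gbh_abs_moment 0 j * duhamel_weight j a b s)"
  let ?g = "\<lambda>y s. indicator {a<..<b} s *\<^sub>R biheat_der j (b - s) (\<lambda>z. N z s) (x - y)"
  have w: "integrable lborel ?w"
    unfolding set_integrable_def[symmetric]
    by (intro set_integrable_mult_right set_integrable_duhamel_weight a j)
  have "biheat_der 0 h (duhamel j a b) x = (\<integral>y. \<integral>s. Gbh_t_der 0 h y * ?g y s \<partial>lborel \<partial>lborel)"
    by (simp only: biheat_der_def[of 0 h] duhamel_def set_lebesgue_integral_def
        integral_mult_right_zero)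
  also have "\<dots> = (\<integral>s. \<integral>y. Gbh_t_der 0 h y * ?g y s \<partial>lborel \<partial>lborel)"
  proof (rule Fubini_dominated[OF integrable_Gbh_t_der[OF h, of 0] w order_refl])
    have "(\<lambda>(y, s). Gbh_t_der 0 h y
        * (indicator {a<..<b} s * (indicator {0<..} s * biheat_der j (b - s) (\<lambda>z. N z s) (x - y))))
        \<in> borel_measurable (borel \<Otimes>\<^sub>M borel)"
      by measurable
    also have "(\<lambda>(y, s). Gbh_t_der 0 h y
        * (indicator {a<..<b} s * (indicator {0<..} s * biheat_der j (b - s) (\<lambda>z. N z s) (x - y))))
        = (\<lambda>(y, s). Gbh_t_der 0 h y * ?g y s)"
      using a by (auto simp: indicator_def fun_eq_iff)
    finally show "(\<lambda>(y, s). Gbh_t_der 0 h y * ?g y s) \<in> borel_measurable (borel \<Otimes>\<^sub>M borel)" .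
    show "\<bar>Gbh_t_der 0 h y * ?g y s\<bar> \<le> \<bar>Gbh_t_der 0 h y\<bar> * \<bar>?w s\<bar>" for y s
      unfolding abs_mult[of "Gbh_t_der 0 h y"]
      using biheat_der_source_bound[OF a(1), of s b j "x - y"]
      by (intro mult_left_mono) (auto simp: indicator_def intro: order_trans[OF _ abs_ge_self])
  qed
  also have "\<dots> = (LINT s:{a<..<b}|lborel. biheat_der j (b + h - s) (\<lambda>z. N z s) x)"
    unfolding set_lebesgue_integral_def
  proof (intro Bochner_Integration.integral_cong refl)
    fix s
    show "(\<integral>y. Gbh_t_der 0 h y * ?g y s \<partial>lborel)
        = indicator {a<..<b} s *\<^sub>R biheat_der j (b + h - s) (\<lambda>z. N z s) x"
      using biheat_der_semigroup[OF h _ poly_growth_source, of "b - s" s j x] a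
      by (simp add: indicator_def biheat_der_def[of 0 h] diff_add_eq)
  qed
  finally show ?thesis .
qed

lemma duhamel_restart:
  assumes "0 \<le> a" "a < b" "h > 0" "j < 4"
  shows "duhamel j a (b + h) x = biheat_der 0 h (duhamel j a b) x + duhamel j b (b + h) x"
  using duhamel_split[of a b "b + h" j x] assms by (simp add: biheat_der_0_duhamel)

lemma duhamel_scaling:
  assumes \<sigma>: "\<sigma> > 0" and a: "0 \<le> a"
    and N: "\<And>y s. s > 0 \<Longrightarrow> N (qroot \<sigma> * y) (\<sigma> * s) = N y s / (qroot \<sigma>)\<^sup>2"
  shows "qroot \<sigma> ^ j * duhamel j (\<sigma> * a) (\<sigma> * b) (qroot \<sigma> * x) = (qroot \<sigma>)\<^sup>2 * duhamel j a b x"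
proof -
  note q = qroot_pos[OF \<sigma>]
  let ?f = "\<lambda>s. indicator {\<sigma> * a<..<\<sigma> * b} s *\<^sub>R biheat_der j (\<sigma> * b - s) (\<lambda>y. N y s) (qroot \<sigma> * x)"
  have "qroot \<sigma> ^ j * duhamel j (\<sigma> * a) (\<sigma> * b) (qroot \<sigma> * x)
      = qroot \<sigma> ^ j * (\<bar>\<sigma>\<bar> *\<^sub>R (\<integral>r. ?f (0 + \<sigma> * r) \<partial>lborel))"
    unfolding duhamel_def set_lebesgue_integral_def
    by (subst lborel_integral_real_affine[of \<sigma> ?f 0]) (use \<sigma> in auto)
  also have "\<dots> = (\<integral>r. qroot \<sigma> ^ j * \<sigma> * ?f (0 + \<sigma> * r) \<partial>lborel)" using \<sigma> by simp
  also have "\<dots> = (\<integral>r. (qroot \<sigma>)\<^sup>2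
      * (indicator {a<..<b} r *\<^sub>R biheat_der j (b - r) (\<lambda>y. N y r) x) \<partial>lborel)"
  proof (intro Bochner_Integration.integral_cong refl)
    fix r
    show "qroot \<sigma> ^ j * \<sigma> * ?f (0 + \<sigma> * r)
        = (qroot \<sigma>)\<^sup>2 * (indicator {a<..<b} r *\<^sub>R biheat_der j (b - r) (\<lambda>y. N y r) x)"
    proof (cases "r \<in> {a<..<b}")
      case True
      have "biheat_der j (\<sigma> * b - \<sigma> * r) (\<lambda>y. N y (\<sigma> * r)) (qroot \<sigma> * x)
          = biheat_der j (b - r) (\<lambda>y. N y r / (qroot \<sigma>)\<^sup>2) x / qroot \<sigma> ^ j"
        using True a biheat_der_scaling[OF \<sigma>, of "b - r" j "\<lambda>y. N y (\<sigma> * r)" x]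
        by (simp add: N right_diff_distrib)
      also have "\<dots> = biheat_der j (b - r) (\<lambda>y. N y r) x / (qroot \<sigma>)\<^sup>2 / qroot \<sigma> ^ j"
        by (simp add: biheat_der_def)
      finally have scaled: "biheat_der j (\<sigma> * b - \<sigma> * r) (\<lambda>y. N y (\<sigma> * r)) (qroot \<sigma> * x)
          = biheat_der j (b - r) (\<lambda>y. N y r) x / (qroot \<sigma>)\<^sup>2 / qroot \<sigma> ^ j" .
      have "\<sigma> = (qroot \<sigma>)\<^sup>2 * (qroot \<sigma>)\<^sup>2"
        using qroot_power4[OF \<sigma>] by (simp flip: power_add)
      then have "qroot \<sigma> ^ j * \<sigma> * (c / (qroot \<sigma>)\<^sup>2 / qroot \<sigma> ^ j) = (qroot \<sigma>)\<^sup>2 * c" for c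
        using q by (simp add: field_simps)
      with True \<sigma> scaled show ?thesis by simp
    qed (use \<sigma> in \<open>simp add: indicator_def\<close>)
  qed
  finally show ?thesis by (simp add: duhamel_def set_lebesgue_integral_def)
qed

end

section \<open>Short-time asymptotics for smooth data\<close>

lemma taylor_remainder_global:
  fixes d :: "nat \<Rightarrow> real \<Rightarrow> real"
  assumes deriv: "\<And>m z. m < n \<Longrightarrow> (d m has_real_derivative d (Suc m) z) (at z)"
    and near: "\<And>z. \<bar>z - x\<bar> \<le> 1 \<Longrightarrow> \<bar>d n z\<bar> \<le> M"
    and far: "\<And>y. \<bar>y\<bar> \<ge> 1 \<Longrightarrow> \<bar>d 0 (x - y)\<bar> \<le> L * \<bar>y\<bar> ^ n"
  shows "\<bar>d 0 (x - y) - (\<Sum>m<n. d m x / fact m * (- y) ^ m)\<bar> \<le> (M + L + (\<Sum>m<n. \<bar>d m x\<bar>)) * \<bar>y\<bar> ^ n"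
proof -
  let ?P = "\<Sum>m<n. d m x / fact m * (- y) ^ m"
  have M: "0 \<le> M * \<bar>y\<bar> ^ n" and L: "0 \<le> L * \<bar>y\<bar> ^ n"
    using near[of x] far[of 1] by (auto intro!: mult_nonneg_nonneg)
  have S: "0 \<le> (\<Sum>m<n. \<bar>d m x\<bar>) * \<bar>y\<bar> ^ n" by (intro mult_nonneg_nonneg sum_nonneg) auto
  show ?thesis
  proof (cases "\<bar>y\<bar> \<le> 1")
    case True
    have "\<forall>m t. m < n \<and> \<bar>t\<bar> \<le> \<bar>- y\<bar> \<longrightarrow>
        ((\<lambda>t. d m (x + t)) has_real_derivative d (Suc m) (x + t)) (at t)"
      using deriv by (simp add: DERIV_shift[symmetric] add.commute[of x])
    from Maclaurin_bi_le[where diff="\<lambda>m t. d m (x + t)", OF refl this]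
    obtain t where t: "\<bar>t\<bar> \<le> \<bar>y\<bar>" and taylor: "d 0 (x - y) = ?P + d n (x + t) / fact n * (- y) ^ n"
      by auto
    have "\<bar>d n (x + t)\<bar> / fact n \<le> M"
      using near[of "x + t"] t True by (intro order_trans[OF divide_left_mono[of 1 "fact n"]]) auto
    then have "\<bar>d n (x + t)\<bar> / fact n * \<bar>y\<bar> ^ n \<le> M * \<bar>y\<bar> ^ n" by (rule mult_right_mono) simp
    then have "\<bar>d 0 (x - y) - ?P\<bar> \<le> M * \<bar>y\<bar> ^ n"
      unfolding taylor by (simp add: abs_mult power_abs)
    with L S show ?thesis unfolding distrib_right by linarith
  next
    case False
    have "\<bar>?P\<bar> \<le> (\<Sum>m<n. \<bar>d m x\<bar> * \<bar>y\<bar> ^ n)"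
    proof (rule order_trans[OF sum_abs sum_mono])
      fix m assume "m \<in> {..<n}"
      then have "\<bar>y\<bar> ^ m \<le> \<bar>y\<bar> ^ n" using False by (intro power_increasing) auto
      moreover have "\<bar>d m x\<bar> / fact m \<le> \<bar>d m x\<bar> / 1" by (intro divide_left_mono) auto
      ultimately have "\<bar>d m x\<bar> / fact m * \<bar>y\<bar> ^ m \<le> \<bar>d m x\<bar> * \<bar>y\<bar> ^ n" by (intro mult_mono) auto
      then show "\<bar>d m x / fact m * (- y) ^ m\<bar> \<le> \<bar>d m x\<bar> * \<bar>y\<bar> ^ n" by (simp add: abs_mult power_abs)
    qed
    then have "\<bar>?P\<bar> \<le> (\<Sum>m<n. \<bar>d m x\<bar>) * \<bar>y\<bar> ^ n" by (simp add: sum_distrib_right)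
    with far[of y] False M show ?thesis unfolding distrib_right by linarith
  qed
qed

lemma biheat_der_1_C2_approx:
  assumes t: "t > 0" and bounded: "\<And>y. \<bar>f y\<bar> \<le> B"
    and f1: "\<And>z. (f has_real_derivative f1 z) (at z)"
    and f2: "\<And>z. (f1 has_real_derivative f2 z) (at z)"
    and M: "\<And>z. \<bar>z - x\<bar> \<le> 1 \<Longrightarrow> \<bar>f2 z\<bar> \<le> M"
  shows "\<bar>biheat_der 1 t f x - f1 x\<bar> \<le> (M + B + (\<bar>f x\<bar> + \<bar>f1 x\<bar>)) * Gbh_abs_moment 2 1 * qroot t"
proof -
  define d where "d m = (if m = 0 then f else if m = 1 then f1 else f2)" for m :: nat
  have remainder: "\<bar>d 0 (x - y) - (\<Sum>m<2. d m x / fact m * (- y) ^ m)\<bar>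
      \<le> (M + B + (\<Sum>m<2. \<bar>d m x\<bar>)) * \<bar>y\<bar> ^ 2" for y
  proof (rule taylor_remainder_global)
    show "(d m has_real_derivative d (Suc m) z) (at z)" if "m < 2" for m z
      using that f1 f2 by (cases "m = 0") (auto simp: d_def)
    show "\<bar>d 2 z\<bar> \<le> M" if "\<bar>z - x\<bar> \<le> 1" for z
      using M[OF that] by (simp add: d_def)
    have "B \<ge> 0" using bounded[of 0] by linarith
    then show "\<bar>d 0 (x - y)\<bar> \<le> B * \<bar>y\<bar> ^ 2" if "\<bar>y\<bar> \<ge> 1" for y
      using bounded[of "x - y"] mult_left_mono[OF one_le_power[OF that, of 2], of B]
      by (simp add: d_def)
  qed
  have "f \<in> borel_measurable borel"
    by (intro borel_measurable_continuous_onI continuous_at_imp_continuous_on ballI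
        DERIV_isCont[OF f1])
  then show ?thesis
    using biheat_der_1_taylor[OF t, of "d 0" x "\<lambda>m. d m x / fact m"] remainder
    by (simp add: d_def numeral_2_eq_2)
qed

lemma biheat_generator_Lipschitz:
  assumes f: "L-lipschitz_on UNIV f" and d0: "d 0 = f"
    and deriv: "\<And>m z. (d m has_real_derivative d (Suc m) z) (at z)"
  shows "((\<lambda>h. (biheat_der 0 h f x - f x) / h) \<longlongrightarrow> - d 4 x) (at_right 0)"
proof -
  have "continuous_on {x - 1..x + 1} (d 5)"
    by (intro continuous_at_imp_continuous_on ballI DERIV_isCont[OF deriv])
  from compact_imp_bounded[OF compact_continuous_image[OF this compact_Icc]]
  obtain M where M: "\<bar>d 5 z\<bar> \<le> M" if "z \<in> {x - 1..x + 1}" for z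
    unfolding bounded_iff real_norm_def by blast
  have remainder: "\<bar>d 0 (x - y) - (\<Sum>m<5. d m x / fact m * (- y) ^ m)\<bar>
      \<le> (M + (\<bar>f x\<bar> + L) + (\<Sum>m<5. \<bar>d m x\<bar>)) * \<bar>y\<bar> ^ 5" for y
  proof (rule taylor_remainder_global)
    show "(d m has_real_derivative d (Suc m) z) (at z)" for m z by (rule deriv)
    show "\<bar>d 5 z\<bar> \<le> M" if "\<bar>z - x\<bar> \<le> 1" for z using that by (intro M) auto
    fix y :: real assume y: "\<bar>y\<bar> \<ge> 1"
    have "\<bar>f (x - y)\<bar> \<le> \<bar>f x\<bar> * 1 + L * \<bar>y\<bar> ^ 1"
      using lipschitz_onD[OF f, of "x - y" x] by (simp add: dist_real_def)
    also have "\<dots> \<le> \<bar>f x\<bar> * \<bar>y\<bar> ^ 5 + L * \<bar>y\<bar> ^ 5"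
      using y lipschitz_on_nonneg[OF f]
      by (intro add_mono mult_left_mono one_le_power power_increasing) auto
    finally show "\<bar>d 0 (x - y)\<bar> \<le> (\<bar>f x\<bar> + L) * \<bar>y\<bar> ^ 5" by (simp add: d0 distrib_right)
  qed
  have "d 0 \<in> borel_measurable borel"
    using poly_growth_Lipschitz[OF f] by (simp add: d0 poly_growth_def)
  from biheat_generator[OF this, of x "\<lambda>m. d m x / fact m", OF remainder]
  show ?thesis by (simp add: d0 fact_numeral)
qed

lemma continuous_on_half_plane_bounded:
  assumes cont: "continuous_on (UNIV \<times> {0<..}) (\<lambda>p. g (fst p) (snd p))" and a: "0 < a"
  shows "\<exists>M::real. \<forall>y\<in>{c..d::real}. \<forall>s\<in>{a..b::real}. \<bar>g y s\<bar> \<le> M"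
proof -
  have "continuous_on ({c..d} \<times> {a..b}) (\<lambda>p. g (fst p) (snd p))"
    by (rule continuous_on_subset[OF cont]) (use a in auto)
  from compact_imp_bounded[OF compact_continuous_image[OF this
      compact_Times[OF compact_Icc compact_Icc]]]
  show ?thesis by (auto simp: bounded_iff)
qed

lemma isCont_half_plane_slice:
  assumes cont: "continuous_on (UNIV \<times> {0<..}) (\<lambda>p. g (fst p) (snd p))" and t: "(t::real) > 0"
  shows "isCont (g x) t"
proof -
  have "continuous_on {0<..} (\<lambda>s. g (fst (x, s)) (snd (x, s)))"
    by (rule continuous_on_compose2[OF cont, where f="Pair x"]) (auto intro!: continuous_intros)
  then show ?thesis using t by (simp add: continuous_on_eq_continuous_at)
qed

context duhamel_source
begin

context
  fixes N1 N2 :: "real \<Rightarrow> real \<Rightarrow> real"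
  assumes deriv1: "\<And>y s. s > 0 \<Longrightarrow> ((\<lambda>y. N y s) has_real_derivative N1 y s) (at y)"
    and deriv2: "\<And>y s. s > 0 \<Longrightarrow> ((\<lambda>y. N1 y s) has_real_derivative N2 y s) (at y)"
    and cont1: "continuous_on (UNIV \<times> {0<..}) (\<lambda>p. N1 (fst p) (snd p))"
    and cont2: "continuous_on (UNIV \<times> {0<..}) (\<lambda>p. N2 (fst p) (snd p))"
begin

lemma biheat_der_1_source_approx:
  assumes t: "t > 0"
  obtains K where "K \<ge> 0"
    "\<And>s \<tau>. t \<le> s \<Longrightarrow> s \<le> t + 1 \<Longrightarrow> \<tau> > 0 \<Longrightarrow> \<bar>biheat_der 1 \<tau> (\<lambda>y. N y s) x - N1 x s\<bar> \<le> K * qroot \<tau>"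
proof -
  obtain M1 where M1: "\<bar>N1 y s\<bar> \<le> M1" if "y \<in> {x - 1..x + 1}" "s \<in> {t..t + 1}" for y s
    using continuous_on_half_plane_bounded[OF cont1 t] by metis
  obtain M2 where M2: "\<bar>N2 y s\<bar> \<le> M2" if "y \<in> {x - 1..x + 1}" "s \<in> {t..t + 1}" for y s
    using continuous_on_half_plane_bounded[OF cont2 t] by metis
  define B where "B = C * t powr (-1/2)"
  have B: "\<bar>N y s\<bar> \<le> B" if "t \<le> s" for y s
    unfolding B_def using t that C_nonneg
    by (intro order_trans[OF source_bound mult_left_mono] powr_mono2') auto
  define K where "K = (M2 + B + (B + M1)) * Gbh_abs_moment 2 1"
  have "\<bar>biheat_der 1 \<tau> (\<lambda>y. N y s) x - N1 x s\<bar> \<le> K * qroot \<tau>" if s: "t \<le> s" "s \<le> t + 1"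
    and \<tau>: "\<tau> > 0" for s \<tau>
  proof -
    have "\<bar>biheat_der 1 \<tau> (\<lambda>y. N y s) x - N1 x s\<bar>
        \<le> (M2 + B + (\<bar>N x s\<bar> + \<bar>N1 x s\<bar>)) * Gbh_abs_moment 2 1 * qroot \<tau>"
      by (rule biheat_der_1_C2_approx[OF \<tau> B[OF s(1)] deriv1 deriv2 M2]) (use s t in auto)
    also have "\<dots> \<le> K * qroot \<tau>"
      unfolding K_def using B[OF s(1), of x] M1[of x s] s
      by (intro mult_right_mono Gbh_abs_moment_nonneg qroot_nonneg) auto
    finally show ?thesis .
  qed
  moreover have "K \<ge> 0"
    unfolding K_def using B[of t x] M1[of x t] M2[of x t]
    by (intro mult_nonneg_nonneg Gbh_abs_moment_nonneg) auto
  ultimately show thesis by (rule that[rotated])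
qed

lemma duhamel_right_derivative:
  assumes t: "t > 0"
  shows "((\<lambda>h. duhamel 1 t (t + h) x / h) \<longlongrightarrow> N1 x t) (at_right 0)"
  unfolding duhamel_def
proof (rule tendsto_set_integral_average)
  show "set_integrable lborel {t<..<t + h} (\<lambda>s. biheat_der 1 (t + h - s) (\<lambda>y. N y s) x)"
    if "h > 0" for h
    by (rule set_integrable_biheat_der_source) (use t that in auto)
  fix e :: real assume e: "e > 0"
  obtain K where K: "K \<ge> 0"
    and approx: "\<And>s \<tau>. t \<le> s \<Longrightarrow> s \<le> t + 1 \<Longrightarrow> \<tau> > 0 \<Longrightarrow>
      \<bar>biheat_der 1 \<tau> (\<lambda>y. N y s) x - N1 x s\<bar> \<le> K * qroot \<tau>"
    using biheat_der_1_source_approx[OF t] by metis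
  obtain d where d: "d > 0" "\<And>s. \<bar>s - t\<bar> < d \<Longrightarrow> \<bar>N1 x s - N1 x t\<bar> < e / 2"
    using isCont_half_plane_slice[OF cont1 t, of x] e
    unfolding continuous_at_eps_delta dist_real_def by (metis divide_pos_pos zero_less_numeral)
  have "\<forall>\<^sub>F h in at_right 0. K * qroot h < e / 2"
    using e by (intro order_tendstoD(2)[OF tendsto_mult_right_zero[OF tendsto_qroot_0]]) simp
  moreover have "\<forall>\<^sub>F h in at_right 0. h \<in> {0<..<min d 1}"
    using d by (intro eventually_at_right_real) auto
  ultimately show "\<forall>\<^sub>F h in at_right 0. \<forall>s\<in>{t<..<t + h}. \<bar>biheat_der 1 (t + h - s) (\<lambda>y. N y s) x
      - N1 x t\<bar> \<le> e"
  proof eventually_elim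
    case (elim h)
    show ?case
    proof
      fix s assume s: "s \<in> {t<..<t + h}"
      have "\<bar>biheat_der 1 (t + h - s) (\<lambda>y. N y s) x - N1 x s\<bar> \<le> K * qroot (t + h - s)"
        using s elim(2) by (intro approx) auto
      also have "\<dots> \<le> K * qroot h"
        using s K by (intro mult_left_mono qroot_mono) auto
      finally have "\<bar>biheat_der 1 (t + h - s) (\<lambda>y. N y s) x - N1 x s\<bar> \<le> K * qroot h" .
      moreover have "\<bar>N1 x s - N1 x t\<bar> < e / 2"
        by (rule d(2)) (use s elim(2) in auto)
      ultimately show "\<bar>biheat_der 1 (t + h - s) (\<lambda>y. N y s) x - N1 x t\<bar> \<le> e"
        using elim(1) by linarith
    qed
  qed
qed

end

end

section \<open>Mild solutions of the forced biharmonic heat equation\<close>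

locale mild_flow = duhamel_source +
  fixes \<phi> :: "real \<Rightarrow> real" and L :: real
  assumes initial_Lipschitz: "L-lipschitz_on UNIV \<phi>"
begin

definition flow :: "real \<Rightarrow> real \<Rightarrow> real" where
  "flow t x = (if t = 0 then \<phi> x else biheat_der 0 t \<phi> x + duhamel 1 0 t x)"

lemma flow_deriv:
  assumes t: "t > 0" and "countable S" "\<And>y. y \<notin> S \<Longrightarrow> (\<phi> has_real_derivative \<phi>' y) (at y)"
    and "\<phi>' \<in> borel_measurable borel"
  shows "(flow t has_real_derivative biheat_der 0 t \<phi>' x + duhamel 2 0 t x) (at x)"
  using DERIV_add[OF biheat_der_deriv_Lipschitz[OF t initial_Lipschitz assms(2-), of 0 x]
      duhamel_deriv[OF order_refl t, of 1 x]] t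
  by (simp add: flow_def[abs_def] numeral_2_eq_2)

lemma flow_restart:
  assumes t: "t \<ge> 0" and h: "h > 0"
  shows "flow (t + h) x = biheat_der 0 h (flow t) x + duhamel 1 t (t + h) x"
proof (cases "t = 0")
  case True
  with h show ?thesis by (simp add: flow_def[abs_def])
next
  case False
  with t have t: "t > 0" by simp
  note initial = poly_growth_Lipschitz[OF initial_Lipschitz]
  have "flow t = (\<lambda>y. biheat_der 0 t \<phi> y + duhamel 1 0 t y)"
    using t by (simp add: flow_def fun_eq_iff)
  then have "biheat_der 0 h (flow t) x
      = biheat_der 0 (t + h) \<phi> x + biheat_der 0 h (duhamel 1 0 t) x"
    using biheat_der_add[OF h poly_growth_biheat_der[OF t initial]
        poly_growth_duhamel[OF order_refl t]]
    by (simp add: biheat_der_semigroup[OF h t initial])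
  then show ?thesis
    using duhamel_restart[OF order_refl t h, of 1 x] t h by (simp add: flow_def)
qed

lemma flow_scaling:
  assumes \<sigma>: "\<sigma> > 0" and t: "t > 0"
    and initial: "\<And>y. \<phi> (qroot \<sigma> * y) = qroot \<sigma> * \<phi> y"
    and source: "\<And>y s. s > 0 \<Longrightarrow> N (qroot \<sigma> * y) (\<sigma> * s) = N y s / (qroot \<sigma>)\<^sup>2"
  shows "flow (\<sigma> * t) (qroot \<sigma> * x) = qroot \<sigma> * flow t x"
proof -
  have "duhamel 1 0 (\<sigma> * t) (qroot \<sigma> * x) = qroot \<sigma> * duhamel 1 0 t x"
    using duhamel_scaling[OF \<sigma> order_refl source, of 1 t x] qroot_pos[OF \<sigma>]
    by (simp add: power2_eq_square)
  moreover have "biheat_der 0 (\<sigma> * t) \<phi> (qroot \<sigma> * x) = qroot \<sigma> * biheat_der 0 t \<phi> x"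
    using biheat_der_scaling[OF \<sigma> t, of 0 \<phi> x]
    by (simp add: initial biheat_der_def mult.left_commute)
  ultimately show ?thesis using \<sigma> t by (simp add: flow_def distrib_left)
qed

end

lemma uniformly_continuous_on_modulus:
  fixes f :: "'a::metric_space \<Rightarrow> 'b::metric_space"
  assumes modulus: "\<And>p q. p \<in> S \<Longrightarrow> q \<in> S \<Longrightarrow> dist (f p) (f q) \<le> \<omega> (dist p q)"
    and lim: "(\<omega> \<longlongrightarrow> 0) (at_right 0)"
  shows "uniformly_continuous_on S f"
  unfolding uniformly_continuous_on_def
proof (intro allI impI)
  fix e :: real assume e: "e > 0"
  then have "\<forall>\<^sub>F r in at_right 0. \<omega> r < e" by (rule order_tendstoD(2)[OF lim])
  then obtain d where d: "d > 0" "\<And>r. 0 < r \<Longrightarrow> r < d \<Longrightarrow> \<omega> r < e"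
    by (auto simp: eventually_at_right[OF zero_less_one])
  have "dist (f q) (f p) < e" if "p \<in> S" "q \<in> S" "dist q p < d" for p q
  proof (cases "p = q")
    case False
    with that d(2)[of "dist q p"] modulus[of q p] show ?thesis by simp
  qed (use e in simp)
  with d(1) show "\<exists>d>0. \<forall>p\<in>S. \<forall>q\<in>S. dist q p < d \<longrightarrow> dist (f q) (f p) < e" by blast
qed

locale Lipschitz_mild_flow = mild_flow +
  assumes flow_Lipschitz_pos: "t > 0 \<Longrightarrow> L-lipschitz_on UNIV (flow t)"
begin

lemma flow_Lipschitz: "t \<ge> 0 \<Longrightarrow> L-lipschitz_on UNIV (flow t)"
  using flow_Lipschitz_pos[of t] initial_Lipschitz by (cases "t = 0") (auto simp: flow_def[abs_def])

definition Hoelder_const :: real where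
  "Hoelder_const = L * Gbh_abs_moment 1 0 + C * Gbh_abs_moment 0 1 * Beta (1/2) (3/4)"

lemma flow_time_increment:
  assumes t: "t \<ge> 0" and h: "h > 0"
  shows "\<bar>flow (t + h) x - flow t x\<bar> \<le> Hoelder_const * qroot h"
proof -
  have "\<bar>biheat_der 0 h (flow t) x - flow t x\<bar> \<le> L * Gbh_abs_moment 1 0 * qroot h"
    by (rule biheat_der_0_minus_Lipschitz[OF h flow_Lipschitz[OF t]])
  moreover have "\<bar>duhamel 1 t (t + h) x\<bar> \<le> C * Gbh_abs_moment 0 1 * Beta (1/2) (3/4) * qroot h"
    using duhamel_bound[OF t, of "t + h" 1 x] h by (simp add: qroot_def)
  ultimately show ?thesis
    unfolding flow_restart[OF t h] Hoelder_const_def distrib_right by linarith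
qed

lemma Hoelder_const_nonneg: "Hoelder_const \<ge> 0"
  using flow_time_increment[of 0 1 0] by (simp add: qroot_def)

lemma flow_modulus:
  assumes "t \<ge> 0" "s \<ge> 0"
  shows "\<bar>flow t x - flow s y\<bar> \<le> L * \<bar>x - y\<bar> + Hoelder_const * qroot \<bar>t - s\<bar>"
proof -
  have time: "\<bar>flow t x - flow s x\<bar> \<le> Hoelder_const * qroot (t - s)" if "s \<ge> 0" "t > s" for t s
    using flow_time_increment[of s "t - s" x] that by simp
  have "\<bar>flow t x - flow s x\<bar> \<le> Hoelder_const * qroot \<bar>t - s\<bar>"
    using time[of s t] time[of t s] assms mult_nonneg_nonneg[OF Hoelder_const_nonneg qroot_nonneg]
    by (cases t s rule: linorder_cases) (auto simp: abs_minus_commute)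
  moreover have "\<bar>flow s x - flow s y\<bar> \<le> L * \<bar>x - y\<bar>"
    using lipschitz_onD[OF flow_Lipschitz[OF assms(2)], of x y] by (simp add: dist_real_def)
  ultimately show ?thesis by linarith
qed

lemma uniformly_continuous_on_flow: "uniformly_continuous_on (UNIV \<times> {0..})
    (\<lambda>p. flow (snd p) (fst p))"
proof (rule uniformly_continuous_on_modulus)
  show "((\<lambda>r. L * r + Hoelder_const * qroot r) \<longlongrightarrow> 0) (at_right 0)"
    by (auto intro!: tendsto_eq_intros tendsto_qroot_0)
  fix p q :: "real \<times> real" assume p: "p \<in> UNIV \<times> {0..}" and q: "q \<in> UNIV \<times> {0..}"
  have "\<bar>flow (snd p) (fst p) - flow (snd q) (fst q)\<bar>
      \<le> L * \<bar>fst p - fst q\<bar> + Hoelder_const * qroot \<bar>snd p - snd q\<bar>"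
    by (rule flow_modulus) (use p q in auto)
  also have "\<dots> \<le> L * dist p q + Hoelder_const * qroot (dist p q)"
    using dist_fst_le[of p q] dist_snd_le[of p q] lipschitz_on_nonneg[OF initial_Lipschitz]
    by (intro add_mono mult_left_mono qroot_mono Hoelder_const_nonneg) (auto simp: dist_real_def)
  finally show "dist (flow (snd p) (fst p)) (flow (snd q) (fst q))
      \<le> L * dist p q + Hoelder_const * qroot (dist p q)"
    by (simp add: dist_real_def)
qed

lemma flow_tendsto_initial: "((\<lambda>p. flow (snd p) (fst p)) \<longlongrightarrow> \<phi> x) (at (x, 0) within UNIV \<times> {0<..})"
proof -
  have "((\<lambda>p. flow (snd p) (fst p)) \<longlongrightarrow> flow 0 x) (at (x, 0) within UNIV \<times> {0..})"
    using uniformly_continuous_imp_continuous[OF uniformly_continuous_on_flow]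
    by (auto simp: continuous_on)
  then have "((\<lambda>p. flow (snd p) (fst p)) \<longlongrightarrow> flow 0 x) (at (x, 0) within UNIV \<times> {0<..})"
    by (rule tendsto_within_subset) auto
  then show ?thesis by (simp add: flow_def[of 0])
qed

lemma flow_right_derivative:
  assumes t: "t > 0"
    and d0: "d 0 = flow t" and deriv: "\<And>m z. (d m has_real_derivative d (Suc m) z) (at z)"
    and source: "((\<lambda>h. duhamel 1 t (t + h) x / h) \<longlongrightarrow> r) (at_right 0)"
  shows "((\<lambda>h. (flow (t + h) x - flow t x) / h) \<longlongrightarrow> - d 4 x + r) (at_right 0)"
proof -
  have "((\<lambda>h. (biheat_der 0 h (flow t) x - flow t x) / h + duhamel 1 t (t + h) x / h)
      \<longlongrightarrow> - d 4 x + r) (at_right 0)"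
    using t by (intro tendsto_add source
        biheat_generator_Lipschitz[OF flow_Lipschitz d0 deriv]) simp
  then show ?thesis
  proof (rule Lim_transform_eventually)
    show "\<forall>\<^sub>F h in at_right 0. (biheat_der 0 h (flow t) x - flow t x) / h
        + duhamel 1 t (t + h) x / h = (flow (t + h) x - flow t x) / h"
      using eventually_at_right_less[of 0]
      by eventually_elim (use t in \<open>simp add: flow_restart add_divide_distrib diff_divide_distrib\<close>)
  qed
qed

end

section \<open>Smooth functions on the half-plane\<close>

lemma Ck_imp_continuous_on: "Ck k S f \<Longrightarrow> continuous_on S f"
  by (cases k) auto

lemma Ck_SucI:
  assumes "continuous_on S f"
    and "\<And>p. p \<in> S \<Longrightarrow> (f has_derivative (\<lambda>h. fst h * f1 p + snd h * f2 p)) (at p)"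
    and "Ck k S f1" "Ck k S f2"
  shows "Ck (Suc k) S f"
  unfolding Ck.simps using assms by blast

lemma Ck_SucE:
  assumes "Ck (Suc k) S f"
  obtains f1 f2 where "continuous_on S f"
    "\<And>p. p \<in> S \<Longrightarrow> (f has_derivative (\<lambda>h. fst h * f1 p + snd h * f2 p)) (at p)"
    "Ck k S f1" "Ck k S f2"
  using assms unfolding Ck.simps by blast

lemma Ck_Suc_imp_Ck: "Ck (Suc k) S f \<Longrightarrow> Ck k S f"
proof (induction k arbitrary: f)
  case (Suc k)
  from Suc.prems show ?case
    by (rule Ck_SucE) (blast intro: Ck_SucI Suc.IH)
qed simp

lemma Ck_cong:
  assumes "open S" "\<And>p. p \<in> S \<Longrightarrow> f p = g p" "Ck k S f"
  shows "Ck k S g"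
proof (cases k)
  case 0
  then show ?thesis using assms by (simp cong: continuous_on_cong)
next
  case (Suc m)
  with assms(3) obtain f1 f2 where f: "continuous_on S f"
    "\<And>p. p \<in> S \<Longrightarrow> (f has_derivative (\<lambda>h. fst h * f1 p + snd h * f2 p)) (at p)"
    "Ck m S f1" "Ck m S f2"
    by (auto elim: Ck_SucE)
  have "(g has_derivative (\<lambda>h. fst h * f1 p + snd h * f2 p)) (at p)" if "p \<in> S" for p
    using f(2) that assms by (intro has_derivative_transform_within_open[of f _ p UNIV S g]) auto
  moreover have "continuous_on S g" using f(1) assms(2) by (simp cong: continuous_on_cong)
  ultimately show ?thesis unfolding Suc using f(3,4) by (intro Ck_SucI)
qed

lemma Ck_const: "Ck k S (\<lambda>_. c)"
proof (induction k arbitrary: c)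
  case (Suc k)
  show ?case by (rule Ck_SucI[where ?f1.0="\<lambda>_. 0" and ?f2.0="\<lambda>_. 0"]) (use Suc in auto)
qed simp

lemma Ck_add: "Ck k S f \<Longrightarrow> Ck k S g \<Longrightarrow> Ck k S (\<lambda>p. f p + g p)"
proof (induction k arbitrary: f g)
  case 0
  then show ?case by (simp add: continuous_on_add)
next
  case (Suc k)
  from Suc.prems(1) obtain f1 f2 where f: "continuous_on S f"
    "\<And>p. p \<in> S \<Longrightarrow> (f has_derivative (\<lambda>h. fst h * f1 p + snd h * f2 p)) (at p)"
    "Ck k S f1" "Ck k S f2"
    by (rule Ck_SucE) blast
  from Suc.prems(2) obtain g1 g2 where g: "continuous_on S g"
    "\<And>p. p \<in> S \<Longrightarrow> (g has_derivative (\<lambda>h. fst h * g1 p + snd h * g2 p)) (at p)"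
    "Ck k S g1" "Ck k S g2"
    by (rule Ck_SucE) blast
  have "((\<lambda>p. f p + g p) has_derivative (\<lambda>h. fst h * (f1 p + g1 p) + snd h * (f2 p + g2 p))) (at p)"
      if "p \<in> S" for p
    using has_derivative_add[OF f(2)[OF that] g(2)[OF that]] by (simp add: algebra_simps)
  then show ?case
    by (rule Ck_SucI[OF continuous_on_add[OF f(1) g(1)] _ Suc.IH[OF f(3) g(3)]
        Suc.IH[OF f(4) g(4)]])
qed

lemma Ck_mult: "Ck k S f \<Longrightarrow> Ck k S g \<Longrightarrow> Ck k S (\<lambda>p. f p * g p)"
proof (induction k arbitrary: f g)
  case 0
  then show ?case by (simp add: continuous_on_mult)
next
  case (Suc k)
  from Suc.prems(1) obtain f1 f2 where f: "continuous_on S f"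
    "\<And>p. p \<in> S \<Longrightarrow> (f has_derivative (\<lambda>h. fst h * f1 p + snd h * f2 p)) (at p)"
    "Ck k S f1" "Ck k S f2"
    by (rule Ck_SucE) blast
  from Suc.prems(2) obtain g1 g2 where g: "continuous_on S g"
    "\<And>p. p \<in> S \<Longrightarrow> (g has_derivative (\<lambda>h. fst h * g1 p + snd h * g2 p)) (at p)"
    "Ck k S g1" "Ck k S g2"
    by (rule Ck_SucE) blast
  note fk = Ck_Suc_imp_Ck[OF Suc.prems(1)] and gk = Ck_Suc_imp_Ck[OF Suc.prems(2)]
  have "((\<lambda>p. f p * g p) has_derivative
      (\<lambda>h. fst h * (f p * g1 p + f1 p * g p) + snd h * (f p * g2 p + f2 p * g p))) (at p)"
    if "p \<in> S" for p
    using has_derivative_mult[OF f(2)[OF that] g(2)[OF that]] by (simp add: algebra_simps)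
  then show ?case
    by (rule Ck_SucI[OF continuous_on_mult[OF f(1) g(1)] _
        Ck_add[OF Suc.IH[OF fk g(3)] Suc.IH[OF f(3) gk]] Ck_add[OF Suc.IH[OF fk g(4)]
            Suc.IH[OF f(4) gk]]])
qed

lemma Ck_inverse: "Ck k S f \<Longrightarrow> (\<And>p. p \<in> S \<Longrightarrow> f p \<noteq> 0) \<Longrightarrow> Ck k S (\<lambda>p. inverse (f p))"
proof (induction k)
  case 0
  then show ?case by (simp add: continuous_on_inverse)
next
  case (Suc k)
  from Suc.prems(1) obtain f1 f2 where f: "continuous_on S f"
    "\<And>p. p \<in> S \<Longrightarrow> (f has_derivative (\<lambda>h. fst h * f1 p + snd h * f2 p)) (at p)"
    "Ck k S f1" "Ck k S f2"
    by (rule Ck_SucE) blast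
  let ?r = "\<lambda>p. inverse (f p)"
  have "(?r has_derivative (\<lambda>h. fst h * (-1 * (f1 p * (?r p * ?r p)))
      + snd h * (-1 * (f2 p * (?r p * ?r p))))) (at p)"
    if "p \<in> S" for p
    using Deriv.has_derivative_inverse[OF Suc.prems(2)[OF that] f(2)[OF that]]
    by (rule has_derivative_eq_rhs) (simp add: fun_eq_iff algebra_simps)
  moreover have "Ck k S (\<lambda>p. -1 * (g p * (?r p * ?r p)))" if "Ck k S g" for g
    by (intro Ck_mult Ck_const that Suc.IH[OF Ck_Suc_imp_Ck[OF Suc.prems(1)] Suc.prems(2)])
  moreover have "continuous_on S ?r"
    using f(1) Suc.prems(2) by (intro continuous_on_inverse) auto
  ultimately show ?case using f(3,4) by (intro Ck_SucI)
qed

definition smooth_half_plane :: "(real \<Rightarrow> real \<Rightarrow> real) \<Rightarrow> bool" where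
  "smooth_half_plane u \<longleftrightarrow> smooth2_on (UNIV \<times> {0<..}) (\<lambda>p. u (fst p) (snd p))"

lemma smooth_half_plane_imp_continuous_on:
  "smooth_half_plane u \<Longrightarrow> continuous_on (UNIV \<times> {0<..}) (\<lambda>p. u (fst p) (snd p))"
  by (auto simp: smooth_half_plane_def smooth2_on_def intro: Ck_imp_continuous_on)

lemma has_real_derivative_fst_slice:
  fixes f :: "real \<times> real \<Rightarrow> real"
  assumes "(f has_derivative (\<lambda>h. fst h * f1 + snd h * f2)) (at (x, t))"
  shows "((\<lambda>y. f (y, t)) has_real_derivative f1) (at x)"
proof -
  have "((\<lambda>y. (y, t)) has_derivative (\<lambda>h. (h, 0))) (at x)" by (auto intro!: derivative_eq_intros)
  from has_derivative_compose[OF this assms] show ?thesis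
    by (simp add: has_field_derivative_def mult_commute_abs)
qed

lemma
  assumes "smooth_half_plane u"
  shows has_real_derivative_dx: "t > 0 \<Longrightarrow> ((\<lambda>y. u y t) has_real_derivative dx u x t) (at x)"
    and smooth_half_plane_dx: "smooth_half_plane (dx u)"
proof -
  let ?S = "UNIV \<times> {0<..} :: (real \<times> real) set"
  have "open ?S" by (intro open_Times) auto
  have deriv_dx: "(\<forall>x. \<forall>t>0. ((\<lambda>y. u y t) has_real_derivative dx u x t) (at x))
      \<and> Ck k ?S (\<lambda>p. dx u (fst p) (snd p))" for k
  proof -
    have "Ck (Suc k) ?S (\<lambda>p. u (fst p) (snd p))"
      using assms unfolding smooth_half_plane_def smooth2_on_def by blast
    then obtain f1 f2 where
      f: "\<And>p. p \<in> ?S \<Longrightarrow> ((\<lambda>p. u (fst p) (snd p))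
          has_derivative (\<lambda>h. fst h * f1 p + snd h * f2 p)) (at p)" "Ck k ?S f1"
      by (rule Ck_SucE) blast
    have slice: "((\<lambda>y. u y t) has_real_derivative f1 (x, t)) (at x)" if "t > 0" for x t
      using has_real_derivative_fst_slice[OF f(1)[of "(x, t)"]] that by simp
    then have dx_eq: "dx u x t = f1 (x, t)" if "t > 0" for x t
      unfolding dx_def using that by (intro DERIV_imp_deriv)
    then have "Ck k ?S (\<lambda>p. dx u (fst p) (snd p))"
      by (intro Ck_cong[OF \<open>open ?S\<close> _ f(2)]) auto
    with dx_eq slice show ?thesis by simp
  qed
  show "smooth_half_plane (dx u)" using deriv_dx by (simp add: smooth_half_plane_def smooth2_on_def)
  show "t > 0 \<Longrightarrow> ((\<lambda>y. u y t) has_real_derivative dx u x t) (at x)" using deriv_dx by blast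
qed

lemma dx_scaling:
  assumes u: "smooth_half_plane u" and \<sigma>: "\<sigma> > 0" and t: "t > 0"
    and scaling: "\<And>y. u (q * y) (\<sigma> * t) = c * u y t"
  shows "q * dx u (q * x) (\<sigma> * t) = c * dx u x t"
proof (rule DERIV_unique)
  have "((\<lambda>y. u (q * y) (\<sigma> * t)) has_real_derivative dx u (q * x) (\<sigma> * t) * q) (at x)"
    by (rule DERIV_chain2[OF has_real_derivative_dx[OF u]])
       (use \<sigma> t in \<open>auto intro!: derivative_eq_intros\<close>)
  then show "((\<lambda>y. u (q * y) (\<sigma> * t)) has_real_derivative q * dx u (q * x) (\<sigma> * t)) (at x)"
    by (simp add: mult.commute)
  show "((\<lambda>y. u (q * y) (\<sigma> * t)) has_real_derivative c * dx u x t) (at x)"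
    unfolding scaling by (rule DERIV_cmult[OF has_real_derivative_dx[OF u t]])
qed

section \<open>The surface diffusion nonlinearity\<close>

lemma smooth_half_plane_Nl:
  assumes v: "smooth_half_plane v" shows "smooth_half_plane (Nl v)"
proof -
  let ?S = "UNIV \<times> {0<..} :: (real \<times> real) set"
  let ?v = "\<lambda>p. v (fst p) (snd p)"
  let ?vx = "\<lambda>p. dx v (fst p) (snd p)" and ?vxx = "\<lambda>p. dx (dx v) (fst p) (snd p)"
  let ?r = "\<lambda>p. inverse (1 + ?v p * ?v p)"
  note vx = smooth_half_plane_dx[OF v]
  note vxx = smooth_half_plane_dx[OF vx]
  have Nl: "(\<lambda>p. Nl v (fst p) (snd p))
      = (\<lambda>p. (1 + -1 * (?r p * ?r p)) * ?vxx p + 3 * ?v p * (?vx p * ?vx p) * (?r p * ?r p * ?r p))"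
    by (simp add: Nl_def alphaN_def FN_def divide_inverse power2_eq_square power3_eq_cube
        fun_eq_iff)
  have nonzero: "1 + ?v p * ?v p \<noteq> 0" for p
    by (metis add_pos_nonneg less_irrefl zero_less_one zero_le_square)
  have "Ck k ?S (\<lambda>p. Nl v (fst p) (snd p))" for k
    using v vx vxx unfolding Nl smooth_half_plane_def smooth2_on_def
    by (intro Ck_add Ck_mult Ck_const Ck_inverse nonzero) auto
  then show ?thesis by (simp add: smooth_half_plane_def smooth2_on_def)
qed

lemma abs_alphaN_le_1: "\<bar>alphaN w\<bar> \<le> 1"
proof -
  have "(1 + w\<^sup>2)\<^sup>2 \<ge> 1" by (rule one_le_power) simp
  then have "1 / (1 + w\<^sup>2)\<^sup>2 \<le> 1" by (intro divide_le_eq_1_pos[THEN iffD2]) linarith+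
  moreover have "0 \<le> 1 / (1 + w\<^sup>2)\<^sup>2" by simp
  ultimately show ?thesis unfolding alphaN_def by linarith
qed

lemma abs_FN_le: "\<bar>FN w wx\<bar> \<le> 3 * wx\<^sup>2"
proof -
  have "0 \<le> (\<bar>w\<bar> - 1)\<^sup>2" by simp
  then have "2 * \<bar>w\<bar> \<le> 1 + w\<^sup>2" by (simp add: power2_diff)
  then have "\<bar>w\<bar> \<le> 1 + w\<^sup>2" by linarith
  also have "\<dots> \<le> (1 + w\<^sup>2) ^ 3" using power_increasing[of 1 3 "1 + w\<^sup>2"] by simp
  finally have "\<bar>w\<bar> / (1 + w\<^sup>2) ^ 3 \<le> 1" by (simp add: divide_le_eq_1 add_pos_nonneg)
  then have "3 * (\<bar>w\<bar> / (1 + w\<^sup>2) ^ 3 * wx\<^sup>2) \<le> 3 * (1 * wx\<^sup>2)"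
    by (intro mult_left_mono mult_right_mono) auto
  then show ?thesis by (simp add: FN_def abs_mult power_abs)
qed

lemma abs_Nl_le:
  assumes "\<bar>dx v x s\<bar> \<le> C1 * s powr (-1/4)" "\<bar>dx (dx v) x s\<bar> \<le> C2 * s powr (-1/2)"
  shows "\<bar>Nl v x s\<bar> \<le> (C2 + 3 * C1\<^sup>2) * s powr (-1/2)"
proof -
  have "\<bar>alphaN (v x s) * dx (dx v) x s\<bar> \<le> C2 * s powr (-1/2)"
    unfolding abs_mult
    using assms(2) mult_left_le_one_le[OF abs_ge_zero abs_ge_zero abs_alphaN_le_1]
    by (rule order_trans[rotated])
  moreover have "\<bar>FN (v x s) (dx v x s)\<bar> \<le> 3 * (C1\<^sup>2 * s powr (-1/2))"
  proof -
    have "\<bar>dx v x s\<bar>\<^sup>2 \<le> (C1 * s powr (-1/4))\<^sup>2" using assms(1) by (intro power_mono) auto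
    also have "\<dots> = C1\<^sup>2 * s powr (-1/2)"
      by (simp add: power_mult_distrib power2_eq_square powr_add[symmetric])
    finally show ?thesis using abs_FN_le[of "v x s" "dx v x s"] by simp
  qed
  ultimately show ?thesis unfolding Nl_def distrib_right by linarith
qed

lemma Nl_scaling:
  assumes v: "smooth_half_plane v" and \<sigma>: "\<sigma> > 0" and t: "t > 0"
    and scaling: "\<And>y. v (qroot \<sigma> * y) (\<sigma> * t) = v y t"
  shows "Nl v (qroot \<sigma> * x) (\<sigma> * t) = Nl v x t / (qroot \<sigma>)\<^sup>2"
proof -
  note q = qroot_pos[OF \<sigma>]
  have vx: "dx v (qroot \<sigma> * y) (\<sigma> * t) = (1 / qroot \<sigma>) * dx v y t" for y
    using dx_scaling[OF v \<sigma> t, of "qroot \<sigma>" 1 y] scaling q by (simp add: field_simps)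
  have vxx: "dx (dx v) (qroot \<sigma> * x) (\<sigma> * t) = dx (dx v) x t / (qroot \<sigma>)\<^sup>2"
    using dx_scaling[OF smooth_half_plane_dx[OF v] \<sigma> t vx, of x] q
    by (simp add: field_simps power2_eq_square)
  show ?thesis
    unfolding Nl_def scaling vx vxx by (simp add: FN_def power_divide add_divide_distrib)
qed

lemma surface_diffusion_flux:
  fixes w w1 :: "real \<Rightarrow> real"
  assumes w: "(w has_real_derivative w1 y) (at y)" and w1: "(w1 has_real_derivative w2) (at y)"
  shows "(1 + (w y)\<^sup>2) powr (-1/2) * deriv (\<lambda>z. w1 z * (1 + (w z)\<^sup>2) powr (-3/2)) y
    = w2 - (alphaN (w y) * w2 + FN (w y) (w1 y))"
proof -
  define r where "r = 1 + (w y)\<^sup>2"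
  have r: "r > 0" by (simp add: r_def add_pos_nonneg)
  have powers: "r powr (-1/2) * r powr (-3/2) = inverse (r ^ 2)"
      "r powr (-1/2) * r powr (-5/2) = inverse (r ^ 3)"
    using r powr_minus[of r 2] powr_minus[of r 3] by (simp_all flip: powr_add)
  have "((\<lambda>z. 1 + (w z)\<^sup>2) has_real_derivative 2 * w y * w1 y) (at y)"
    using w by (auto intro!: derivative_eq_intros)
  from DERIV_mult[OF w1 DERIV_fun_powr[OF this, of "-3/2"]] r
  have "deriv (\<lambda>z. w1 z * (1 + (w z)\<^sup>2) powr (-3/2)) y
      = w2 * r powr (-3/2) - 3 * w y * (w1 y)\<^sup>2 * r powr (-5/2)"
    by (auto dest!: DERIV_imp_deriv simp: r_def power2_eq_square)
  then have "r powr (-1/2) * deriv (\<lambda>z. w1 z * (1 + (w z)\<^sup>2) powr (-3/2)) y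
      = w2 * (r powr (-1/2) * r powr (-3/2)) - 3 * w y * (w1 y)\<^sup>2 * (r powr (-1/2) * r powr (-5/2))"
    by (simp only: right_diff_distrib mult_ac)
  also have "\<dots> = w2 - (alphaN (w y) * w2 + FN (w y) (w1 y))"
    unfolding powers alphaN_def FN_def r_def[symmetric] by (simp add: divide_inverse algebra_simps)
  finally show ?thesis by (simp only: r_def)
qed

section \<open>Graphs whose slope is a mild solution\<close>

locale mild_graph_solution =
  fixes v U :: "real \<Rightarrow> real \<Rightarrow> real" and \<phi> \<phi>' :: "real \<Rightarrow> real" and S :: "real set"
    and L C1 C2 :: real
  assumes v_smooth: "smooth_half_plane v"
    and v_bound: "\<And>x t. t > 0 \<Longrightarrow> \<bar>v x t\<bar> \<le> L"
    and vx_bound: "\<And>x t. t > 0 \<Longrightarrow> \<bar>dx v x t\<bar> \<le> C1 * t powr (-1/4)"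
    and vxx_bound: "\<And>x t. t > 0 \<Longrightarrow> \<bar>dx (dx v) x t\<bar> \<le> C2 * t powr (-1/2)"
    and \<phi>_Lipschitz: "L-lipschitz_on UNIV \<phi>"
    and countable_S: "countable S"
    and \<phi>_deriv: "\<And>x. x \<notin> S \<Longrightarrow> (\<phi> has_real_derivative \<phi>' x) (at x)"
    and poly_growth_\<phi>': "poly_growth \<phi>'"
    and v_mild: "\<And>x t. t > 0 \<Longrightarrow> v x t =
      biheat t \<phi>' x + integral {0..t} (\<lambda>s. (deriv ^^ 2) (biheat (t - s) (\<lambda>y. Nl v y s)) x)"
    and U_mild: "\<And>x t. t > 0 \<Longrightarrow> U x t =
      biheat t \<phi> x + integral {0..t} (\<lambda>s. deriv (biheat (t - s) (\<lambda>y. Nl v y s)) x)"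
begin

sublocale mild_flow "Nl v" "C2 + 3 * C1\<^sup>2" \<phi> L
proof unfold_locales
  show "continuous_on (UNIV \<times> {0<..}) (\<lambda>p. Nl v (fst p) (snd p))"
    by (intro smooth_half_plane_imp_continuous_on smooth_half_plane_Nl v_smooth)
  show "\<bar>Nl v y s\<bar> \<le> (C2 + 3 * C1\<^sup>2) * s powr (-1/2)" if "s > 0" for y s
    using that by (intro abs_Nl_le vx_bound vxx_bound)
qed (rule \<phi>_Lipschitz)

lemma U_eq_flow: "t > 0 \<Longrightarrow> U x t = flow t x"
  using U_mild[of t x] integral_deriv_biheat_source[of t 1 x] poly_growth_Lipschitz[OF \<phi>_Lipschitz]
  by (simp add: flow_def biheat_eq_biheat_der)

lemma flow_deriv_v:
  assumes t: "t > 0" shows "(flow t has_real_derivative v x t) (at x)"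
  using flow_deriv[OF t countable_S \<phi>_deriv] v_mild[OF t, of x]
    poly_growth_\<phi>' integral_deriv_biheat_source[OF t, of 2 x]
  by (simp add: biheat_eq_biheat_der[OF t poly_growth_\<phi>'] poly_growth_def)

lemma U_deriv: "t > 0 \<Longrightarrow> ((\<lambda>y. U y t) has_real_derivative v x t) (at x)"
  using flow_deriv_v by (simp add: U_eq_flow)

sublocale Lipschitz_mild_flow "Nl v" "C2 + 3 * C1\<^sup>2" \<phi> L
proof
  fix t :: real assume t: "t > 0"
  have "norm (flow t x - flow t y) \<le> L * norm (x - y)" for x y
    by (rule field_differentiable_bound[of UNIV _ "\<lambda>y. v y t"])
       (use flow_deriv_v[OF t] v_bound[OF t] in auto)
  then show "L-lipschitz_on UNIV (flow t)"
    using lipschitz_on_nonneg[OF \<phi>_Lipschitz] by (intro lipschitz_onI) (simp_all add: dist_real_def)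
qed

lemma U_uniformly_continuous: "uniformly_continuous_on (UNIV \<times> {0<..}) (\<lambda>p. U (fst p) (snd p))"
  using uniformly_continuous_on_flow unfolding uniformly_continuous_on_def
  by (force simp: U_eq_flow)

lemma U_tendsto_initial: "((\<lambda>p. U (fst p) (snd p)) \<longlongrightarrow> \<phi> x) (at (x, 0) within UNIV \<times> {0<..})"
proof (rule Lim_transform_eventually[OF flow_tendsto_initial])
  show "\<forall>\<^sub>F p in at (x, 0) within UNIV \<times> {0<..}. flow (snd p) (fst p) = U (fst p) (snd p)"
    unfolding eventually_at_filter by (rule always_eventually) (auto simp: U_eq_flow)
qed

lemma surface_diffusion_eq:
  assumes t: "t > 0"
  shows "- deriv (\<lambda>y. (1 + (dx U y t)\<^sup>2) powr (-1/2)
      * deriv (\<lambda>z. dx (dx U) z t * (1 + (dx U z t)\<^sup>2) powr (-3/2)) y) x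
    = - dx (dx (dx v)) x t + dx (Nl v) x t"
proof -
  note vx = smooth_half_plane_dx[OF v_smooth]
  note vxx = smooth_half_plane_dx[OF vx]
  have Ux: "dx U y t = v y t" for y
    unfolding dx_def by (rule DERIV_imp_deriv[OF U_deriv[OF t]])
  then have Uxx: "dx (dx U) y t = dx v y t" for y
    unfolding dx_def[of "dx U"] dx_def[of v] by simp
  have "(\<lambda>y. (1 + (dx U y t)\<^sup>2) powr (-1/2)
      * deriv (\<lambda>z. dx (dx U) z t * (1 + (dx U z t)\<^sup>2) powr (-3/2)) y)
      = (\<lambda>y. dx (dx v) y t - Nl v y t)"
    unfolding Ux Uxx Nl_def
    by (intro ext surface_diffusion_flux has_real_derivative_dx[OF v_smooth t]
        has_real_derivative_dx[OF vx t])
  moreover have "deriv (\<lambda>y. dx (dx v) y t - Nl v y t) x = dx (dx (dx v)) x t - dx (Nl v) x t"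
    by (intro DERIV_imp_deriv DERIV_diff has_real_derivative_dx[OF vxx t]
        has_real_derivative_dx[OF smooth_half_plane_Nl[OF v_smooth] t])
  ultimately show ?thesis by simp
qed

lemma U_right_derivative:
  assumes t: "t > 0"
  shows "((\<lambda>h. (U x (t + h) - U x t) / h) \<longlongrightarrow> - dx (dx (dx v)) x t + dx (Nl v) x t) (at_right 0)"
proof -
  define d where "d m = (if m = 0 then flow t else (\<lambda>z. (dx ^^ (m - 1)) v z t))" for m :: nat
  have "smooth_half_plane ((dx ^^ m) v)" for m
    by (induction m) (auto intro: v_smooth smooth_half_plane_dx)
  then have deriv: "(d m has_real_derivative d (Suc m) z) (at z)" for m z
    using flow_deriv_v[OF t] has_real_derivative_dx[OF _ t, of "(dx ^^ (m - 1)) v" z]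
    by (cases m) (auto simp: d_def)
  note N = smooth_half_plane_Nl[OF v_smooth]
  note Nx = smooth_half_plane_dx[OF N]
  have source: "((\<lambda>h. duhamel 1 t (t + h) x / h) \<longlongrightarrow> dx (Nl v) x t) (at_right 0)"
    by (rule duhamel_right_derivative[OF has_real_derivative_dx[OF N] has_real_derivative_dx[OF Nx]
          smooth_half_plane_imp_continuous_on[OF Nx]
          smooth_half_plane_imp_continuous_on[OF smooth_half_plane_dx[OF Nx]] t])
  have "((\<lambda>h. (flow (t + h) x - flow t x) / h) \<longlongrightarrow> - d 4 x + dx (Nl v) x t) (at_right 0)"
    by (rule flow_right_derivative[OF t _ _ source]) (simp add: d_def, rule deriv)
  moreover have "d 4 x = dx (dx (dx v)) x t" by (simp add: d_def numeral_3_eq_3)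
  moreover have "\<forall>\<^sub>F h in at_right 0. (flow (t + h) x - flow t x) / h = (U x (t + h) - U x t) / h"
    using eventually_at_right_less[of 0] by eventually_elim (use t in \<open>simp add: U_eq_flow\<close>)
  ultimately show ?thesis by (auto intro: Lim_transform_eventually)
qed

end

locale selfsimilar_mild_graph_solution = mild_graph_solution +
  assumes \<phi>_homogeneous: "\<And>q x. q > 0 \<Longrightarrow> \<phi> (q * x) = q * \<phi> x"
    and v_selfsimilar: "\<And>x t \<sigma>. t > 0 \<Longrightarrow> \<sigma> > 0 \<Longrightarrow> v (\<sigma> powr (1/4) * x) (\<sigma> * t) = v x t"
begin

lemma U_scaling:
  assumes t: "t > 0" and \<sigma>: "\<sigma> > 0"
  shows "U (qroot \<sigma> * x) (\<sigma> * t) = qroot \<sigma> * U x t"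
  using flow_scaling[OF \<sigma> t \<phi>_homogeneous[OF qroot_pos[OF \<sigma>]], of x]
    Nl_scaling[OF v_smooth \<sigma>] v_selfsimilar \<sigma> t
  by (simp add: U_eq_flow qroot_def)

lemma U_selfsimilar:
  assumes "t > 0" and \<sigma>: "\<sigma> > 0"
  shows "\<sigma> powr (-1/4) * U (\<sigma> powr (1/4) * x) (\<sigma> * t) = U x t"
proof -
  have "\<sigma> powr (-1/4) * qroot \<sigma> = 1" using \<sigma> by (simp add: qroot_def flip: powr_add)
  then show ?thesis using U_scaling[OF assms, of x] by (simp add: qroot_def mult.assoc[symmetric])
qed

lemma U_time_differentiable:
  assumes t: "t > 0" shows "\<exists>D. ((\<lambda>s. U x s) has_real_derivative D) (at t)"
proof -
  obtain q' where q': "(qroot has_real_derivative q') (at t)"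
    unfolding qroot_def[abs_def] using has_real_derivative_powr[OF t] by blast
  obtain r' where "((\<lambda>s. x / qroot s) has_real_derivative r') (at t)"
    using DERIV_divide[OF DERIV_const[of x] q'] qroot_pos[OF t] by force
  from DERIV_mult[OF q' DERIV_chain2[OF U_deriv[OF zero_less_one] this]] obtain D where
    "((\<lambda>s. qroot s * U (x / qroot s) 1) has_real_derivative D) (at t)" by blast
  then have "((\<lambda>s. U x s) has_real_derivative D) (at t)"
  proof (rule has_field_derivative_transform_within_open[of _ _ _ "{0<..}"])
    fix s :: real assume "s \<in> {0<..}"
    then show "qroot s * U (x / qroot s) 1 = U x s"
      using U_scaling[of 1 s "x / qroot s"] qroot_pos[of s] by simp
  qed (use t in auto)
  then show ?thesis by blast
qed

lemma U_solves_surface_diffusion: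
  assumes t: "t > 0"
  shows "((\<lambda>s. U x s) has_real_derivative
    - deriv (\<lambda>y. (1 + (dx U y t)\<^sup>2) powr (-1/2) * deriv
        (\<lambda>z. dx (dx U) z t * (1 + (dx U z t)\<^sup>2) powr (-3/2)) y) x) (at t)"
proof -
  obtain D where D: "((\<lambda>s. U x s) has_real_derivative D) (at t)"
    using U_time_differentiable[OF t] by blast
  with DERIV_eq_right_limit[OF D U_right_derivative[OF t]] show ?thesis
    by (simp only: surface_diffusion_eq[OF t])
qed

end

lemma phiAB_Lipschitz: "(\<bar>A\<bar> + \<bar>B\<bar>)-lipschitz_on UNIV (phiAB A B)"
proof (rule lipschitz_onI)
  fix x y :: real
  have phiAB: "phiAB A B z = A * max z 0 + B * max (- z) 0" for z by (simp add: phiAB_def max_def)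
  have "phiAB A B x - phiAB A B y = A * (max x 0 - max y 0) + B * (max (- x) 0 - max (- y) 0)"
    unfolding phiAB by (simp add: algebra_simps)
  also have "\<bar>\<dots>\<bar> \<le> \<bar>A\<bar> * \<bar>max x 0 - max y 0\<bar> + \<bar>B\<bar> * \<bar>max (- x) 0 - max (- y) 0\<bar>"
    by (rule order_trans[OF abs_triangle_ineq]) (simp add: abs_mult)
  also have "\<dots> \<le> \<bar>A\<bar> * \<bar>x - y\<bar> + \<bar>B\<bar> * \<bar>x - y\<bar>"
    by (intro add_mono mult_left_mono) auto
  finally show "dist (phiAB A B x) (phiAB A B y) \<le> (\<bar>A\<bar> + \<bar>B\<bar>) * dist x y"
    by (simp add: dist_real_def distrib_right)
qed simp

lemma phiAB_homogeneous: "q > 0 \<Longrightarrow> phiAB A B (q * y) = q * phiAB A B y"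
  by (simp add: phiAB_def zero_le_mult_iff)

lemma phiAB_deriv:
  assumes "x \<noteq> 0"
  shows "(phiAB A B has_real_derivative (if x < 0 then - B else A)) (at x)"
proof -
  have "((\<lambda>y. c * y) has_real_derivative c) (at x)" for c by (auto intro!: derivative_eq_intros)
  then show ?thesis
    by (rule has_field_derivative_transform_within_open[of _ _ _
        "if x < 0 then {..<0} else {0<..}"])
       (use assms in \<open>auto simp: phiAB_def split: if_splits\<close>)
qed

theorem theorem5p6:
  fixes A B :: real and v U :: "real \<Rightarrow> real \<Rightarrow> real"
  assumes smooth: "smooth2_on (UNIV \<times> {0<..}) (\<lambda>p. v (fst p) (snd p))"
    and bd0: "\<exists>C0. \<forall>x. \<forall>t>0. \<bar>v x t\<bar> \<le> C0"
    and bd1: "\<exists>C1. \<forall>x. \<forall>t>0. \<bar>dx v x t\<bar> \<le> C1 * t powr (-1/4)"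
    and bd2: "\<exists>C2. \<forall>x. \<forall>t>0. \<bar>dx (dx v) x t\<bar> \<le> C2 * t powr (-1/2)"
    and mild: "\<forall>x. \<forall>t>0. v x t =
        biheat t (\<lambda>y. if y < 0 then - B else A) x
        + integral {0..t} (\<lambda>s. (deriv ^^ 2) (biheat (t - s) (\<lambda>y. Nl v y s)) x)"
    and selfsim: "\<forall>x. \<forall>t>0. \<forall>\<sigma>>0. v (\<sigma> powr (1/4) * x) (\<sigma> * t) = v x t"
    and U_def: "\<forall>x. \<forall>t>0. U x t =
        biheat t (phiAB A B) x
        + integral {0..t} (\<lambda>s. deriv (biheat (t - s) (\<lambda>y. Nl v y s)) x)"
  shows "uniformly_continuous_on (UNIV \<times> {0<..}) (\<lambda>p. U (fst p) (snd p))
    \<and> (\<forall>x. ((\<lambda>p. U (fst p) (snd p)) \<longlongrightarrow> phiAB A B x) (at (x, 0) within UNIV \<times> {0<..}))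
    \<and> (\<forall>x. \<forall>t>0. ((\<lambda>y. U y t) has_real_derivative v x t) (at x))
    \<and> (\<forall>x. \<forall>t>0. ((\<lambda>s. U x s) has_real_derivative
          - deriv (\<lambda>y. (1 + (dx U y t)\<^sup>2) powr (-1/2)
               * deriv (\<lambda>z. dx (dx U) z t * (1 + (dx U z t)\<^sup>2) powr (-3/2)) y) x) (at t))
    \<and> (\<forall>x. \<forall>t>0. \<forall>\<sigma>>0. \<sigma> powr (-1/4) * U (\<sigma> powr (1/4) * x) (\<sigma> * t) = U x t)"
proof -
  obtain C0 where C0: "\<And>x t. t > 0 \<Longrightarrow> \<bar>v x t\<bar> \<le> C0" using bd0 by blast
  obtain C1 where C1: "\<And>x t. t > 0 \<Longrightarrow> \<bar>dx v x t\<bar> \<le> C1 * t powr (-1/4)" using bd1 by blast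
  obtain C2 where C2: "\<And>x t. t > 0 \<Longrightarrow> \<bar>dx (dx v) x t\<bar> \<le> C2 * t powr (-1/2)" using bd2 by blast
  let ?v\<^sub>0 = "\<lambda>y. if y < 0 then - B else A" and ?L = "max C0 (\<bar>A\<bar> + \<bar>B\<bar>)"
  interpret selfsimilar_mild_graph_solution v U "phiAB A B" ?v\<^sub>0 "{0}" ?L C1 C2
  proof unfold_locales
    show "smooth_half_plane v" using smooth by (simp add: smooth_half_plane_def)
    show "\<bar>v x t\<bar> \<le> ?L" if "t > 0" for x t using C0[OF that] by (rule max.coboundedI1)
    show "?L-lipschitz_on UNIV (phiAB A B)" by (rule lipschitz_on_mono[OF phiAB_Lipschitz]) auto
    show "poly_growth ?v\<^sub>0" by (rule poly_growth_bounded[of _ "\<bar>A\<bar> + \<bar>B\<bar>"]) auto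
  qed (use C1 C2 mild selfsim U_def phiAB_deriv phiAB_homogeneous in auto)
  show ?thesis
    using U_uniformly_continuous U_tendsto_initial U_deriv U_solves_surface_diffusion U_selfsimilar
    by blast
qed

end
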